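(* Let $k\ge2$ be an integer, $\varepsilon_k=1/k$, $X$ uniform over $[0,1)$, and assume that $s:[0,1)\to\mathbb{R}$ is twice differentiable and that $C_3>0$ satisfies $|s(t)-s(x)-s'(x)(t-x)-\frac12s''(x)(t-x)^2|\le C_3|t-x|^3$ for all $t,x\in[0,1)$. Write $\mathcal{B}(x)=\mathcal{B}_{\mathcal{U}_k^{\mathtt{toy}},\infty}(x)$. Then for every $x\in[\varepsilon_k,1-\varepsilon_k]$, $$\Big|\mathcal{B}(x)-\frac{(s''(x))^2}{144k^4}\Big|\le\frac{3C_3\big(\|s''\|_\infty+\frac{3C_3}2\big)}{4k^5},$$ and for every $x\in(0,1)\setminus[\varepsilon_k,1-\varepsilon_k]$, $$\Big|\mathcal{B}(x)-\frac{(s'(x))^2(1-k\min\{x,1-x\})^4}{16k^2}\Big|\le\frac{\|s'\|_\infty\|s''\|_\infty+2C_3\|s'\|_\infty+\|s''\|_\infty^2+C_3\|s''\|_\infty+2C_3^2}{4k^3}.$$ As a consequence, $$\Big|\int_0^1\mathcal{B}(x)dx-\frac1{16k^2}\int_0^{1/k}\big[(s'(x))^2+(s'(1-x))^2\big](1-kx)^4dx\Big|\le\frac{\|s'\|_\infty\|s''\|_\infty+2C_3\|s'\|_\infty+\|s''\|_\infty^2+2C_3\|s''\|_\infty+4C_3^2}{2k^4}$$ and $$\Big|\int_{\varepsilon_k}^{1-\varepsilon_k}\mathcal{B}(x)dx-\frac1{144k^4}\int_{\varepsilon_k}^{1-\varepsilon_k}(s''(x))^2dx\Big|\le\frac{3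C_3\big(\|s''\|_\infty+\frac{3C_3}2\big)}{4k^5}.$$
   Context: $\mathbb{U}\sim\mathcal{U}_k^{\mathtt{toy}}$ means $\mathbb{U}=\{[0,\frac{1-T}{k}),[\frac{1-T}{k},\frac{2-T}{k}),\dots,[\frac{k-T}{k},1)\}$ with $T$ uniform over $[0,1)$. For a partition $\mathbb{U}$ of $[0,1)$ into intervals, $I_{\mathbb{U}}(x)$ is the cell containing $x$ and $\tilde s_{\mathbb{U}}(x)=\mathbb{E}[s(X)\mid X\in I_{\mathbb{U}}(x)]=\frac1{|I_{\mathbb{U}}(x)|}\int_{I_{\mathbb{U}}(x)}s(t)dt$. For a distribution $\mathcal{U}$ on partitions, $\mathcal{B}_{\mathcal{U},\infty}(x)=(s(x)-\mathbb{E}_{\mathbb{U}\sim\mathcal{U}}[\tilde s_{\mathbb{U}}(x)])^2$. $\|\cdot\|_\infty$ is the sup-norm on $[0,1)$. *)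

theory Defs
  imports "HOL-Probability.Probability"
begin

text \<open>The last cell is empty for \<open>t = 0\<close>; this is harmless, since cells are only ever selected by a
  point they contain.\<close>

definition toy_partition :: "nat \<Rightarrow> real \<Rightarrow> real set set" where
  "toy_partition k t =
     {{0..<(1 - t) / real k}}
       \<union> {{(real j - t) / real k..<(real j + 1 - t) / real k} | j. 1 \<le> j \<and> j < k}
       \<union> {{(real k - t) / real k..<1}}"

text \<open>The law of \<open>toy_partition k T\<close> for \<open>T\<close> uniform over \<open>[0,1)\<close>, i.e. distributed according to the
  restriction of Lebesgue measure to \<open>[0,1)\<close>. There is no canonical \<open>\<sigma>\<close>-algebra on the set of
  partitions; we take the largest one that makes the map measurable, so that
  the expectation of \<open>f U\<close> is always the integral of \<open>f (toy_partition k t)\<close> over \<open>t\<close> in \<open>[0,1)\<close>.\<close>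

definition toy_distribution :: "nat \<Rightarrow> real set set measure" where
  "toy_distribution k =
     distr (restrict_space lborel {0..<1})
           (sigma UNIV {A. toy_partition k -` A \<inter> {0..<1} \<in> sets borel})
           (toy_partition k)"

definition cell :: "real set set \<Rightarrow> real \<Rightarrow> real set" where
  "cell U x = (THE I. I \<in> U \<and> x \<in> I)"

text \<open>\<open>E[s(X) | X \<in> A]\<close>, the expectation conditional on an event, as \<open>E[s(X) 1{X \<in> A}] / P(X \<in> A)\<close>.\<close>

definition cond_mean :: "'a measure \<Rightarrow> ('a \<Rightarrow> real) \<Rightarrow> (real \<Rightarrow> real) \<Rightarrow> real set \<Rightarrow> real" where
  "cond_mean M X s A =
     (\<integral>\<omega>. s (X \<omega>) * indicator A (X \<omega>) \<partial>M) / measure M {\<omega> \<in> space M. X \<omega> \<in> A}"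

definition s_tilde ::
    "'a measure \<Rightarrow> ('a \<Rightarrow> real) \<Rightarrow> (real \<Rightarrow> real) \<Rightarrow> real set set \<Rightarrow> real \<Rightarrow> real" where
  "s_tilde M X s U x = cond_mean M X s (cell U x)"

definition bias_inf ::
    "'a measure \<Rightarrow> ('a \<Rightarrow> real) \<Rightarrow> (real \<Rightarrow> real) \<Rightarrow> real set set measure \<Rightarrow> real \<Rightarrow> real" where
  "bias_inf M X s P x = (s x - (\<integral>U. s_tilde M X s U x \<partial>P))\<^sup>2"

definition sup_norm :: "(real \<Rightarrow> real) \<Rightarrow> real" where
  "sup_norm f = (SUP x\<in>{0..<1}. \<bar>f x\<bar>)"

lemma sets_toy_distribution:
  "sets (toy_distribution k) = {A. toy_partition k -` A \<inter> {0..<1} \<in> sets borel}"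
proof -
  have "sigma_algebra UNIV {A. toy_partition k -` A \<inter> {0..<1} \<in> sets borel}"
    unfolding sigma_algebra_iff2
  proof (intro conjI ballI allI impI)
    fix A assume "A \<in> {A. toy_partition k -` A \<inter> {0..<1} \<in> sets borel}"
    then have "{0..<1} - (toy_partition k -` A \<inter> {0..<1}) \<in> sets borel"
      by (intro sets.Diff) auto
    moreover have "toy_partition k -` (UNIV - A) \<inter> {0..<1} = {0..<1} - (toy_partition k -` A \<inter> {0..<1})"
      by auto
    ultimately show "UNIV - A \<in> {A. toy_partition k -` A \<inter> {0..<1} \<in> sets borel}"
      by simp
  next
    fix A :: "nat \<Rightarrow> _"
    assume "range A \<subseteq> {A. toy_partition k -` A \<inter> {0..<1} \<in> sets borel}"
    then have "(\<Union>i. toy_partition k -` A i \<inter> {0..<1}) \<in> sets borel"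
      by (intro sets.countable_UN) auto
    moreover have "toy_partition k -` (\<Union>i. A i) \<inter> {0..<1} = (\<Union>i. toy_partition k -` A i \<inter> {0..<1})"
      by auto
    ultimately show "\<Union>(range A) \<in> {A. toy_partition k -` A \<inter> {0..<1} \<in> sets borel}"
      by simp
  qed auto
  then show ?thesis
    by (simp add: toy_distribution_def sigma_algebra.sigma_sets_eq)
qed

lemma integral_toy_distribution:
  fixes f :: "real set set \<Rightarrow> real"
  shows "(\<integral>U. f U \<partial>toy_distribution k) = (LINT t:{0..<1}|lborel. f (toy_partition k t))"
proof -
  let ?R = "restrict_space lborel {0..<1::real}"
  let ?N = "sigma UNIV {A. toy_partition k -` A \<inter> {0..<1} \<in> sets borel}"
  have sN: "sets ?N = {A. toy_partition k -` A \<inter> {0..<1} \<in> sets borel}"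
    using sets_toy_distribution[of k] by (simp add: toy_distribution_def)
  have spN: "space ?N = UNIV"
    by (simp add: space_measure_of_conv)
  have sR: "A \<in> sets ?R \<longleftrightarrow> A \<subseteq> {0..<1} \<and> A \<in> sets borel" for A
    by (subst sets_restrict_space_iff) auto
  have g: "toy_partition k \<in> measurable ?R ?N"
    by (rule measurableI) (auto simp: spN sN sR space_restrict_space)
  have R: "(\<integral>t. f (toy_partition k t) \<partial>?R) = (LINT t:{0..<1}|lborel. f (toy_partition k t))"
    by (subst integral_restrict_space) (auto simp: set_lebesgue_integral_def)
  show ?thesis
  proof (cases "f \<in> borel_measurable ?N")
    case True
    then show ?thesis
      unfolding R[symmetric] toy_distribution_def using g by (rule integral_distr[rotated])
  next
    case False
    have "(\<lambda>t. f (toy_partition k t)) \<notin> borel_measurable ?R"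
    proof
      assume m: "(\<lambda>t. f (toy_partition k t)) \<in> borel_measurable ?R"
      have "f \<in> borel_measurable ?N"
      proof (rule measurableI)
        fix B :: "real set" assume "B \<in> sets borel"
        from measurable_sets[OF m this] show "f -` B \<inter> space ?N \<in> sets ?N"
          unfolding spN sN sR by (simp add: space_restrict_space vimage_def Int_def conj_commute)
      qed simp
      with False show False by simp
    qed
    then have "\<not> integrable ?R (\<lambda>t. f (toy_partition k t))"
      by (meson borel_measurable_integrable)
    moreover have "\<not> integrable (toy_distribution k) f"
      using False borel_measurable_integrable[of "toy_distribution k" f]
      by (auto simp: toy_distribution_def)
    ultimately show ?thesis
      unfolding R[symmetric] by (simp add: not_integrable_integral_eq)
  qed
qed

lemma cond_mean_eq_average:
  fixes X :: "'a \<Rightarrow> real"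
  assumes X: "X \<in> borel_measurable M" and law: "distr M borel X = uniform_measure lborel {0..<1}"
    and I: "I \<in> sets borel" "I \<subseteq> {0..<1}" and s: "set_borel_measurable borel I s"
  shows "cond_mean M X s I = (LINT t:I|lborel. s t) / measure lborel I"
proof -
  have m: "(\<lambda>t. s t * indicator I t) \<in> borel_measurable borel"
    using s by (simp add: set_borel_measurable_def mult.commute)
  have "(\<integral>\<omega>. s (X \<omega>) * indicator I (X \<omega>) \<partial>M) = (\<integral>t. s t * indicator I t \<partial>distr M borel X)"
    using X m by (subst integral_distr) auto
  also have "\<dots> = (\<integral>t. s t * indicator I t \<partial>uniform_measure lborel {0..<1})"
    by (simp only: law)
  also have "uniform_measure lborel {0..<1} = density lborel (\<lambda>t. ennreal (indicator {0..<1::real} t))"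
    by (simp add: uniform_measure_def divide_ennreal_def ennreal_indicator)
  also have "(\<integral>t. s t * indicator I t \<partial>\<dots>) = (\<integral>t. indicator {0..<1} t *\<^sub>R (s t * indicator I t) \<partial>lborel)"
    using m by (intro integral_density) auto
  also have "\<dots> = (LINT t:I|lborel. s t)"
    unfolding set_lebesgue_integral_def using I(2)
    by (intro Bochner_Integration.integral_cong) (auto simp: indicator_def)
  finally have 1: "(\<integral>\<omega>. s (X \<omega>) * indicator I (X \<omega>) \<partial>M) = (LINT t:I|lborel. s t)" .
  have "measure M {\<omega> \<in> space M. X \<omega> \<in> I} = measure (distr M borel X) I"
    using X I by (subst measure_distr) (auto simp: vimage_def Int_def conj_commute)
  also have "\<dots> = measure lborel I"
    unfolding law using I by (simp add: measure_uniform_measure Int_absorb1)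
  finally show ?thesis
    by (simp add: cond_mean_def 1)
qed

end

theory Submission
  imports Defs
begin

text \<open>
  Put \<open>j = \<lfloor>k x + t\<rfloor>\<close>. In the toy partition with shift \<open>t\<close>, the cell of \<open>x\<close> is the interval from
  \<open>(j - t) / k\<close> to \<open>(j + 1 - t) / k\<close>, truncated to \<open>[0,1)\<close> (\<open>cell_toy_partition\<close>). Hence it has length at most
  \<open>1/k\<close>, and integrating the Taylor expansion of \<open>s\<close> at \<open>x\<close> over the cell and then over \<open>t\<close> gives

  \<open>E[s_tilde x] - s x = s' x * m\<^sub>1 x + s'' x / 2 * m\<^sub>2 x + O(C / k\<^sup>3)\<close>

  where \<open>m\<^sub>1\<close> and \<open>m\<^sub>2\<close> are the first two moments about \<open>x\<close> of the random cell (\<open>toy_mean_estimate\<close>).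

  If \<open>x\<close> is at distance at least \<open>1/k\<close> from \<open>0\<close> and \<open>1\<close>, its relative position in the cell is uniform, so
  \<open>m\<^sub>1 x = 0\<close> and \<open>m\<^sub>2 x = 1 / (6 k\<^sup>2)\<close>; the difference is \<open>s'' x / (12 k\<^sup>2)\<close> to leading order. Closer to an end
  point the truncation pulls the cell inwards, \<open>m\<^sub>1 x\<close> equals \<open>(1 - k x)\<^sup>2 / (4 k)\<close> at the left end and
  the negative of its mirror image at the right end, and \<open>m\<^sub>2 x\<close> is only needed to be at most \<open>1 / k\<^sup>2\<close>.
  Squaring, with \<open>\<bar>a\<^sup>2 - b\<^sup>2\<bar> \<le> e (e + 2 c)\<close> for \<open>\<bar>a - b\<bar> \<le> e\<close> and \<open>\<bar>b\<bar> \<le> c\<close>, yields the pointwise bounds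
  (\<open>squared_error_interior\<close>, \<open>squared_error_boundary\<close>), and integrating them yields the other two.

  Two points need care. The suprema of \<open>\<bar>s'\<bar>\<close> and \<open>\<bar>s''\<bar>\<close> are meaningful only if they are finite; this
  follows from the Taylor bound, which makes \<open>s''\<close> Lipschitz (\<open>lipschitz_s''\<close>). And the bias has to be
  shown measurable in \<open>x\<close> before it can be integrated (\<open>set_borel_measurable_toy_mean\<close>).
\<close>

section \<open>Integration on the unit interval, and an inequality for squares\<close>

text \<open>Functions are controlled on \<open>[0,1)\<close> only; the value at \<open>1\<close> does not matter.\<close>

lemma set_integrable_unit_interval:
  fixes f :: "real \<Rightarrow> real"
  assumes f: "set_borel_measurable borel {0..<1} f"
    and bound: "\<And>x. x \<in> {0..<1} \<Longrightarrow> \<bar>f x\<bar> \<le> B"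
    and A: "A \<in> sets borel" "A \<subseteq> {0..1}"
  shows "set_integrable lborel A f"
proof -
  have "set_integrable lborel {0..<1} f"
    unfolding set_integrable_def
    by (rule integrableI_bounded_set[where A = "{0..<1}" and B = B])
      (use f bound in \<open>auto simp: set_borel_measurable_def\<close>)
  then have "set_integrable lborel (A - {1}) f"
    by (rule set_integrable_subset) (use A in \<open>auto simp: less_le\<close>)
  also have "set_integrable lborel (A - {1}) f \<longleftrightarrow> set_integrable lborel A f"
    by (rule set_integrable_discrete_difference[where X = "{1}"]) auto
  finally show ?thesis .
qed

text \<open>The exceptional set \<open>N\<close> absorbs end points at which a pointwise estimate fails.\<close>

lemma set_integral_diff_le:
  fixes f g :: "real \<Rightarrow> real"
  assumes f: "set_integrable lborel A f" and g: "set_integrable lborel A g"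
    and A: "A \<in> sets borel" "emeasure lborel A < \<infinity>" and N: "finite N"
    and le: "\<And>x. x \<in> A - N \<Longrightarrow> \<bar>f x - g x\<bar> \<le> e"
  shows "\<bar>(LBINT x:A. f x) - (LBINT x:A. g x)\<bar> \<le> e * measure lborel A"
proof -
  have fg: "set_integrable lborel A (\<lambda>x. f x - g x)"
    using f g by (rule set_integral_diff)
  have "\<bar>(LBINT x:A. f x) - (LBINT x:A. g x)\<bar> = norm (LBINT x:A. f x - g x)"
    using f g by (simp add: set_integral_diff)
  also have "\<dots> \<le> (LBINT x:A. norm (f x - g x))"
    by (rule set_integral_norm_bound[OF fg])
  also have "\<dots> \<le> (LBINT x:A. e)"
  proof (rule set_integral_mono_AE)
    show "set_integrable lborel A (\<lambda>x. norm (f x - g x))"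
      using fg by (rule set_integrable_norm)
    show "set_integrable lborel A (\<lambda>x. e)"
      using A by (simp add: set_integrable_def)
    have "AE x in lborel. x \<notin> N"
      using N by (intro AE_not_in finite_imp_null_set_lborel)
    then show "AE x\<in>A in lborel. norm (f x - g x) \<le> e"
      by eventually_elim (use le in auto)
  qed
  also have "\<dots> = e * measure lborel A"
    using A by (simp add: set_lebesgue_integral_def)
  finally show ?thesis .
qed

lemma
  fixes f F :: "real \<Rightarrow> real"
  assumes "a \<le> b" and F: "\<And>x. (F has_real_derivative f x) (at x)" and f: "\<And>x. isCont f x"
  shows set_integrable_half_open_FTC: "set_integrable lborel {a..<b} f"
    and set_integral_half_open_FTC: "(LBINT x:{a..<b}. f x) = F b - F a"
proof -
  have *: "has_bochner_integral lborel (\<lambda>x. f x * indicator {a..b} x) (F b - F a)"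
    by (rule has_bochner_integral_FTC_Icc_real) (use assms in auto)
  have "set_integrable lborel {a..b} f"
    using * by (simp add: set_integrable_def has_bochner_integral_iff mult.commute)
  then show "set_integrable lborel {a..<b} f"
    by (rule set_integrable_subset) auto
  have "(LBINT x:{a..<b}. f x) = (LBINT x:{a..b}. f x)"
    by (rule set_integral_discrete_difference[where X = "{b}"]) (use assms in auto)
  then show "(LBINT x:{a..<b}. f x) = F b - F a"
    using * by (simp add: set_lebesgue_integral_def has_bochner_integral_iff mult.commute)
qed

text \<open>Integral over \<open>[0,1)\<close> of a function given by one formula before \<open>c\<close> and another one after.\<close>

lemma set_integral_two_pieces_FTC:
  fixes f p q P Q :: "real \<Rightarrow> real"
  assumes c: "0 \<le> c" "c \<le> 1"
    and P: "\<And>x. (P has_real_derivative p x) (at x)" "\<And>x. isCont p x"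
    and Q: "\<And>x. (Q has_real_derivative q x) (at x)" "\<And>x. isCont q x"
    and p: "\<And>t. 0 \<le> t \<Longrightarrow> t < c \<Longrightarrow> f t = p t" and q: "\<And>t. c \<le> t \<Longrightarrow> t < 1 \<Longrightarrow> f t = q t"
  shows "(LBINT t:{0..<1}. f t) = P c - P 0 + (Q 1 - Q c)"
proof -
  have fp: "(LBINT t:{0..<c}. f t) = P c - P 0" "set_integrable lborel {0..<c} f"
    using set_integral_half_open_FTC[OF c(1) P] set_integrable_half_open_FTC[OF c(1) P] p
      set_lebesgue_integral_cong[of "{0..<c}" lborel f p] set_integrable_cong[of lborel lborel "{0..<c}" "{0..<c}" f p]
    by auto
  have fq: "(LBINT t:{c..<1}. f t) = Q 1 - Q c" "set_integrable lborel {c..<1} f"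
    using set_integral_half_open_FTC[OF c(2) Q] set_integrable_half_open_FTC[OF c(2) Q] q
      set_lebesgue_integral_cong[of "{c..<1}" lborel f q] set_integrable_cong[of lborel lborel "{c..<1}" "{c..<1}" f q]
    by auto
  have "{0..<1} = {0..<c} \<union> {c..<1}"
    using c by auto
  then show ?thesis
    using fp fq by (simp only:) (subst set_integral_Un; auto)
qed

text \<open>Since \<open>frac (a + t)\<close> is again uniform when \<open>t\<close> is, shifting does not change the integral.\<close>

lemma set_integral_frac_FTC:
  fixes g G :: "real \<Rightarrow> real"
  assumes G: "\<And>x. (G has_real_derivative g x) (at x)" and g: "\<And>x. isCont g x"
  shows "(LBINT t:{0..<1}. g (frac (a + t))) = G 1 - G 0"
proof -
  define u where "u = frac a"
  have u: "0 \<le> u" "u < 1"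
    by (auto simp: u_def frac_lt_1)
  have 1: "frac (a + t) = u + t" if "0 \<le> t" "t < 1 - u" for t
    using that u by (simp add: frac_unique_iff) (simp add: u_def frac_def)
  have 2: "frac (a + t) = u + t - 1" if "1 - u \<le> t" "t < 1" for t
    using that u by (simp add: frac_unique_iff) (simp add: u_def frac_def)
  have "(LBINT t:{0..<1}. g (frac (a + t))) =
    G (u + (1 - u)) - G (u + 0) + (G (u + 1 - 1) - G (u + (1 - u) - 1))"
  proof (rule set_integral_two_pieces_FTC[where p = "\<lambda>t. g (u + t)" and q = "\<lambda>t. g (u + t - 1)"])
    show "((\<lambda>t. G (u + t)) has_real_derivative g (u + x)) (at x)" for x
      by (rule DERIV_cong[OF DERIV_chain2[OF G]]) (auto intro!: derivative_eq_intros)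
    show "((\<lambda>t. G (u + t - 1)) has_real_derivative g (u + x - 1)) (at x)" for x
      by (rule DERIV_cong[OF DERIV_chain2[OF G]]) (auto intro!: derivative_eq_intros)
    show "isCont (\<lambda>t. g (u + t)) x" "isCont (\<lambda>t. g (u + t - 1)) x" for x
      by (intro isCont_o2[OF _ g] continuous_intros)+
  qed (use u 1 2 in auto)
  then show ?thesis by simp
qed

lemma
  fixes f :: "real \<Rightarrow> real"
  shows set_lebesgue_integral_one_minus: "(LBINT x:{1 - d..1}. f x) = (LBINT x:{0..d}. f (1 - x))"
    and set_integrable_one_minus: "set_integrable lborel {1 - d..1} f \<longleftrightarrow> set_integrable lborel {0..d} (\<lambda>x. f (1 - x))"
proof -
  have *: "indicator {1 - d..1} (1 + - 1 * x) *\<^sub>R f (1 + - 1 * x) = indicator {0..d} x *\<^sub>R f (1 - x)" for x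
    by (auto simp: indicator_def)
  show "(LBINT x:{1 - d..1}. f x) = (LBINT x:{0..d}. f (1 - x))"
    unfolding set_lebesgue_integral_def
    by (subst lborel_integral_real_affine[where c = "-1" and t = 1]) (simp_all only: *, simp)
  show "set_integrable lborel {1 - d..1} f \<longleftrightarrow> set_integrable lborel {0..d} (\<lambda>x. f (1 - x))"
    unfolding set_integrable_def
    by (subst lborel_integrable_real_affine_iff[where c = "-1" and t = 1, symmetric]) (simp, simp only: *)
qed

lemma abs_diff_squares_le:
  fixes a b e c :: real
  assumes "\<bar>a - b\<bar> \<le> e" "\<bar>b\<bar> \<le> c"
  shows "\<bar>a\<^sup>2 - b\<^sup>2\<bar> \<le> e * (e + 2 * c)"
proof -
  have "\<bar>a\<^sup>2 - b\<^sup>2\<bar> = \<bar>a - b\<bar> * \<bar>a + b\<bar>"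
    by (simp add: abs_mult[symmetric] power2_eq_square algebra_simps)
  also have "\<dots> \<le> e * (e + 2 * c)"
    using assms by (intro mult_mono) auto
  finally show ?thesis .
qed

section \<open>The cells of the toy partition\<close>

text \<open>The cut points of \<open>toy_partition k t\<close> are the numbers \<open>(j - t) / k\<close>, and the largest one that is
  at most \<open>x\<close> is the one with \<open>j = \<lfloor>k x + t\<rfloor>\<close>. Truncation to \<open>[0,1]\<close> takes care of the first and the last cell,
  so that for \<open>x\<close> and \<open>t\<close> in \<open>[0,1)\<close> the cell of \<open>x\<close> is \<open>[toy_left k t x, toy_right k t x)\<close>.\<close>

definition toy_left :: "nat \<Rightarrow> real \<Rightarrow> real \<Rightarrow> real" where
  "toy_left k t x = max 0 ((of_int \<lfloor>real k * x + t\<rfloor> - t) / real k)"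

definition toy_right :: "nat \<Rightarrow> real \<Rightarrow> real \<Rightarrow> real" where
  "toy_right k t x = min 1 ((of_int \<lfloor>real k * x + t\<rfloor> + 1 - t) / real k)"

lemma toy_cell_bounds:
  assumes "k > 0" "t \<in> {0..<1}" "x \<in> {0..<1}"
  shows "0 \<le> toy_left k t x" "toy_left k t x \<le> x" "x < toy_right k t x" "toy_right k t x \<le> 1"
    "toy_right k t x - toy_left k t x \<le> 1 / real k"
proof -
  let ?j = "of_int \<lfloor>real k * x + t\<rfloor> :: real"
  have j: "?j \<le> real k * x + t" "real k * x + t < ?j + 1"
    by linarith+
  have l: "(?j - t) / real k \<le> x" and r: "x < (?j + 1 - t) / real k"
    using j \<open>k > 0\<close> by (auto simp: field_simps)
  have w: "(?j + 1 - t) / real k - (?j - t) / real k = 1 / real k"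
    by (simp add: diff_divide_distrib[symmetric])
  show "0 \<le> toy_left k t x" "toy_left k t x \<le> x" "x < toy_right k t x" "toy_right k t x \<le> 1"
    using l r assms by (auto simp: toy_left_def toy_right_def)
  show "toy_right k t x - toy_left k t x \<le> 1 / real k"
    using w by (auto simp: toy_left_def toy_right_def)
qed

lemma cell_toy_partition:
  assumes k: "k > 0" and t: "t \<in> {0..<1}" and x: "x \<in> {0..<1}"
  shows "cell (toy_partition k t) x = {toy_left k t x..<toy_right k t x}"
proof -
  define n where "n = nat \<lfloor>real k * x + t\<rfloor>"
  have fl: "\<lfloor>real k * x + t\<rfloor> = int n"
    using t x by (simp add: n_def)
  have n: "real n \<le> real k * x + t" "real k * x + t < real n + 1"
    using fl by linarith+
  have "real k * x < real k"
    using k x by simp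
  then have "real n < real k + 1"
    using n t by auto
  then have nk: "n \<le> k"
    by linarith
  have floor_eq: "\<lfloor>real k * x + t\<rfloor> = int j" if "x \<in> {(real j - t) / real k..<(real j + 1 - t) / real k}" for j
    using that k by (intro floor_unique) (auto simp: field_simps)
  have cells: "I = {toy_left k t x..<toy_right k t x}"
    if I: "I \<in> toy_partition k t" and xI: "x \<in> I" for I
  proof -
    consider "I = {0..<(1 - t) / real k}"
      | j where "I = {(real j - t) / real k..<(real j + 1 - t) / real k}" "1 \<le> j" "j < k"
      | "I = {(real k - t) / real k..<1}"
      using I by (auto simp: toy_partition_def)
    then show ?thesis
    proof cases
      case 1
      have "\<lfloor>real k * x + t\<rfloor> = int 0"
        by (rule floor_eq) (use 1 xI k t x in \<open>auto simp: field_simps intro: order_trans[of _ 0]\<close>)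
      moreover have "- t / real k \<le> 0" "(1 - t) / real k \<le> 1"
        using k t by (auto simp: divide_simps)
      ultimately show ?thesis
        using 1 by (simp add: toy_left_def toy_right_def)
    next
      case (2 j)
      have "\<lfloor>real k * x + t\<rfloor> = int j"
        by (rule floor_eq) (use 2 xI in auto)
      moreover have "0 \<le> (real j - t) / real k" "(real j + 1 - t) / real k \<le> 1"
        using 2 k t by (auto simp: divide_simps)
      ultimately show ?thesis
        using 2 by (simp add: toy_left_def toy_right_def)
    next
      case 3
      have "1 \<le> (real k + 1 - t) / real k"
        using k t by (auto simp: divide_simps)
      then have "\<lfloor>real k * x + t\<rfloor> = int k"
        by (intro floor_eq) (use 3 xI in auto)
      moreover have "0 \<le> (real k - t) / real k"
        using k t by (auto simp: divide_simps)
      ultimately show ?thesis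
        using 3 \<open>1 \<le> (real k + 1 - t) / real k\<close> by (simp add: toy_left_def toy_right_def)
    qed
  qed
  moreover have "\<exists>I \<in> toy_partition k t. x \<in> I"
  proof -
    consider "n = 0" | "1 \<le> n" "n < k" | "n = k"
      using nk by linarith
    then show ?thesis
    proof cases
      case 1
      then have "x \<in> {0..<(1 - t) / real k}"
        using n x k by (simp add: field_simps)
      then show ?thesis by (auto simp: toy_partition_def)
    next
      case 2
      then have "x \<in> {(real n - t) / real k..<(real n + 1 - t) / real k}"
        using n k by (simp add: field_simps)
      then show ?thesis
        using 2 unfolding toy_partition_def by blast
    next
      case 3
      then have "x \<in> {(real k - t) / real k..<1}"
        using n x k by (simp add: field_simps)
      then show ?thesis by (auto simp: toy_partition_def)
    qed
  qed
  ultimately show ?thesis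
    unfolding cell_def by (intro the_equality) (metis, metis)
qed

lemma borel_measurable_toy_left [measurable]:
  "(\<lambda>(x, t). toy_left k t x) \<in> borel_measurable (borel \<Otimes>\<^sub>M borel)"
  unfolding toy_left_def by measurable

lemma borel_measurable_toy_right [measurable]:
  "(\<lambda>(x, t). toy_right k t x) \<in> borel_measurable (borel \<Otimes>\<^sub>M borel)"
  unfolding toy_right_def by measurable

section \<open>The expected cell average\<close>

text \<open>The mean of \<open>f\<close> over the interval \<open>[a,b)\<close>, for \<open>a < b\<close>.\<close>

definition average :: "(real \<Rightarrow> real) \<Rightarrow> real \<Rightarrow> real \<Rightarrow> real" where
  "average f a b = (LBINT y:{a..<b}. f y) / (b - a)"

text \<open>The expectation of the mean of \<open>f\<close> over the cell of \<open>x\<close>, when the toy partition is random.\<close>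

definition toy_mean :: "(real \<Rightarrow> real) \<Rightarrow> nat \<Rightarrow> real \<Rightarrow> real" where
  "toy_mean f k x = (LBINT t:{0..<1}. average f (toy_left k t x) (toy_right k t x))"

lemma borel_measurable_average [measurable]:
  assumes f [measurable]: "f \<in> borel_measurable borel"
  shows "(\<lambda>(a, b). average f a b) \<in> borel_measurable (borel \<Otimes>\<^sub>M borel)"
proof -
  have "(LBINT y:{a..<b}. f y) = (LBINT y. if a \<le> y \<and> y < b then f y else 0)" for a b :: real
    unfolding set_lebesgue_integral_def by (intro Bochner_Integration.integral_cong) auto
  then show ?thesis
    unfolding average_def by simp
qed

lemma average_cong:
  assumes "\<And>y. y \<in> {a..<b} \<Longrightarrow> f y = g y"
  shows "average f a b = average g a b"
  unfolding average_def using assms set_lebesgue_integral_cong[of "{a..<b}" lborel f g] by simp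

lemma borel_measurable_toy_average:
  assumes [measurable]: "f \<in> borel_measurable borel"
  shows "(\<lambda>t. average f (toy_left k t x) (toy_right k t x)) \<in> borel_measurable borel"
  using borel_measurable_average[of f] by measurable

lemma borel_measurable_toy_mean:
  assumes [measurable]: "f \<in> borel_measurable borel"
  shows "toy_mean f k \<in> borel_measurable borel"
  unfolding toy_mean_def set_lebesgue_integral_def by measurable

lemma abs_average_le:
  assumes f: "set_borel_measurable borel {0..<1} f" and B: "\<And>y. y \<in> {0..<1} \<Longrightarrow> \<bar>f y\<bar> \<le> B"
    and ab: "0 \<le> a" "a < b" "b \<le> 1"
  shows "\<bar>average f a b\<bar> \<le> B"
proof -
  have "\<bar>(LBINT y:{a..<b}. f y) - (LBINT y:{a..<b}. 0)\<bar> \<le> B * measure lborel {a..<b}"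
    by (rule set_integral_diff_le[OF set_integrable_unit_interval[OF f B] _ _ _ finite.emptyI])
      (use ab B in \<open>auto simp: set_integrable_def\<close>)
  then show ?thesis
    using ab by (simp add: average_def abs_divide pos_divide_le_eq)
qed

lemma set_integrable_toy_average:
  assumes f: "set_borel_measurable borel {0..<1} f" and B: "\<And>y. y \<in> {0..<1} \<Longrightarrow> \<bar>f y\<bar> \<le> B"
    and k: "k > 0" and x: "x \<in> {0..<1}"
  shows "set_integrable lborel {0..<1} (\<lambda>t. average f (toy_left k t x) (toy_right k t x))"
proof (rule set_integrable_unit_interval)
  let ?f = "\<lambda>y. indicator {0..<1} y *\<^sub>R f y"
  have [measurable]: "?f \<in> borel_measurable borel"
    using f by (simp add: set_borel_measurable_def)
  have "average f (toy_left k t x) (toy_right k t x) = average ?f (toy_left k t x) (toy_right k t x)"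
    if "t \<in> {0..<1}" for t
    using toy_cell_bounds[OF k that x] by (intro average_cong) auto
  then have "(\<lambda>t. indicator {0..<1} t *\<^sub>R average f (toy_left k t x) (toy_right k t x)) =
    (\<lambda>t. indicator {0..<1} t *\<^sub>R average ?f (toy_left k t x) (toy_right k t x))"
    by (auto simp: indicator_def)
  moreover have [measurable]: "(\<lambda>t. average ?f (toy_left k t x) (toy_right k t x)) \<in> borel_measurable borel"
    by (rule borel_measurable_toy_average) measurable
  ultimately show "set_borel_measurable borel {0..<1} (\<lambda>t. average f (toy_left k t x) (toy_right k t x))"
    unfolding set_borel_measurable_def by (simp only:) measurable
  show "\<bar>average f (toy_left k t x) (toy_right k t x)\<bar> \<le> B" if "t \<in> {0..<1}" for t
    using toy_cell_bounds[OF k that x] by (intro abs_average_le[OF f B]) auto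
qed auto

lemma abs_toy_mean_le:
  assumes f: "set_borel_measurable borel {0..<1} f" and B: "\<And>y. y \<in> {0..<1} \<Longrightarrow> \<bar>f y\<bar> \<le> B"
    and k: "k > 0" and x: "x \<in> {0..<1}"
  shows "\<bar>toy_mean f k x\<bar> \<le> B"
proof -
  have "\<bar>(LBINT t:{0..<1::real}. average f (toy_left k t x) (toy_right k t x)) - (LBINT t:{0..<1::real}. 0)\<bar>
      \<le> B * measure lborel {0..<1::real}"
  proof (rule set_integral_diff_le[OF set_integrable_toy_average[OF f B k x] _ _ _ finite.emptyI])
    show "\<bar>average f (toy_left k t x) (toy_right k t x) - 0\<bar> \<le> B" if "t \<in> {0..<1} - {}" for t
      using toy_cell_bounds[OF k _ x, of t] that abs_average_le[OF f B] by auto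
  qed (auto simp: set_integrable_def)
  then show ?thesis
    by (simp add: toy_mean_def)
qed

text \<open>Only the values of \<open>f\<close> on \<open>[0,1)\<close> enter, so \<open>f\<close> can be replaced by a function that is Borel on the
  whole line, for which joint measurability in \<open>x\<close> and \<open>t\<close> is available.\<close>

lemma set_borel_measurable_toy_mean:
  assumes f: "set_borel_measurable borel {0..<1} f" and k: "k > 0"
  shows "set_borel_measurable borel {0..<1} (toy_mean f k)"
proof -
  let ?f = "\<lambda>y. indicator {0..<1} y *\<^sub>R f y"
  have m [measurable]: "?f \<in> borel_measurable borel"
    using f by (simp add: set_borel_measurable_def)
  have "toy_mean f k x = toy_mean ?f k x" if x: "x \<in> {0..<1}" for x
    unfolding toy_mean_def
  proof (rule set_lebesgue_integral_cong)
    have "average f (toy_left k t x) (toy_right k t x) = average ?f (toy_left k t x) (toy_right k t x)"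
      if "t \<in> {0..<1}" for t
      using toy_cell_bounds[OF k that x] by (intro average_cong) auto
    then show "\<forall>t. t \<in> {0..<1} \<longrightarrow> average f (toy_left k t x) (toy_right k t x) =
      average ?f (toy_left k t x) (toy_right k t x)"
      by blast
  qed auto
  then have "(\<lambda>x. indicator {0..<1} x *\<^sub>R toy_mean f k x) = (\<lambda>x. indicator {0..<1} x *\<^sub>R toy_mean ?f k x)"
    by (auto simp: indicator_def)
  then show ?thesis
    using borel_measurable_toy_mean[OF m, of k] unfolding set_borel_measurable_def by (simp only:) measurable
qed

lemma s_tilde_toy_partition:
  assumes X: "X \<in> borel_measurable M" "distr M borel X = uniform_measure lborel {0..<1}"
    and f: "set_borel_measurable borel {0..<1} f"
    and k: "k > 0" and t: "t \<in> {0..<1}" and x: "x \<in> {0..<1}"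
  shows "s_tilde M X f (toy_partition k t) x = average f (toy_left k t x) (toy_right k t x)"
proof -
  note b = toy_cell_bounds[OF k t x]
  have sub: "{toy_left k t x..<toy_right k t x} \<subseteq> {0..<1}"
    using b by auto
  have "set_borel_measurable borel {toy_left k t x..<toy_right k t x} f"
    by (rule set_borel_measurable_subset[OF f _ sub]) auto
  then show ?thesis
    using b unfolding s_tilde_def cell_toy_partition[OF k t x] average_def
    by (subst cond_mean_eq_average[OF X _ sub]) auto
qed

lemma bias_inf_toy_distribution:
  assumes X: "X \<in> borel_measurable M" "distr M borel X = uniform_measure lborel {0..<1}"
    and f: "set_borel_measurable borel {0..<1} f"
    and k: "k > 0" and x: "x \<in> {0..<1}"
  shows "bias_inf M X f (toy_distribution k) x = (toy_mean f k x - f x)\<^sup>2"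
proof -
  have "(\<integral>U. s_tilde M X f U x \<partial>toy_distribution k) = toy_mean f k x"
    unfolding integral_toy_distribution toy_mean_def
    using s_tilde_toy_partition[OF X f k _ x]
    by (intro set_lebesgue_integral_cong) auto
  then show ?thesis
    by (simp add: bias_inf_def power2_commute)
qed

section \<open>Moments of the cell around a point\<close>

text \<open>These are the expectations over the random cell \<open>[l,r)\<close> of \<open>x\<close> of the mean of \<open>y - x\<close>, respectively
  of \<open>(y - x)\<^sup>2\<close>, where \<open>y\<close> is uniform over \<open>[l,r)\<close>. The inner means are written in closed form.\<close>

definition toy_moment1 :: "nat \<Rightarrow> real \<Rightarrow> real" where
  "toy_moment1 k x = (LBINT t:{0..<1}. (toy_left k t x + toy_right k t x) / 2 - x)"

definition toy_moment2 :: "nat \<Rightarrow> real \<Rightarrow> real" where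
  "toy_moment2 k x = (LBINT t:{0..<1}.
     ((toy_right k t x - x) ^ 3 - (toy_left k t x - x) ^ 3) / (3 * (toy_right k t x - toy_left k t x)))"

text \<open>At distance at least \<open>1/k\<close> from the end points the cell is not truncated: it has length \<open>1/k\<close>, and
  \<open>x\<close> divides it in the ratio \<open>u : 1 - u\<close> with \<open>u\<close> uniform over \<open>[0,1)\<close>.\<close>

lemma toy_cell_interior:
  assumes k: "k > 0" and x: "x \<in> {1 / real k..1 - 1 / real k}"
  shows "toy_left k t x = x - frac (real k * x + t) / real k"
    "toy_right k t x = x + (1 - frac (real k * x + t)) / real k"
proof -
  let ?u = "frac (real k * x + t)"
  have u: "0 \<le> ?u" "?u < 1"
    by (auto simp: frac_lt_1)
  have fl: "of_int \<lfloor>real k * x + t\<rfloor> = real k * x + t - ?u"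
    by (simp add: frac_def)
  have l: "(of_int \<lfloor>real k * x + t\<rfloor> - t) / real k = x - ?u / real k"
    using k unfolding fl by (simp add: field_simps)
  have r: "(of_int \<lfloor>real k * x + t\<rfloor> + 1 - t) / real k = x + (1 - ?u) / real k"
    using k unfolding fl by (simp add: field_simps)
  have "?u / real k \<le> 1 / real k" "(1 - ?u) / real k \<le> 1 / real k"
    using u by (auto intro!: divide_right_mono)
  then show "toy_left k t x = x - ?u / real k" "toy_right k t x = x + (1 - ?u) / real k"
    using x unfolding toy_left_def toy_right_def l r by auto
qed

lemma toy_moment1_interior:
  assumes k: "k > 0" and x: "x \<in> {1 / real k..1 - 1 / real k}"
  shows "toy_moment1 k x = 0"
proof -
  have "(toy_left k t x + toy_right k t x) / 2 - x = (1/2 - frac (real k * x + t)) / real k" for t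
    using k unfolding toy_cell_interior[OF k x] by (simp add: field_simps)
  then have "toy_moment1 k x = (LBINT t:{0..<1}. (\<lambda>u. (1/2 - u) / real k) (frac (real k * x + t)))"
    unfolding toy_moment1_def by simp
  also have "\<dots> = (\<lambda>u. (u / 2 - u\<^sup>2 / 2) / real k) 1 - (\<lambda>u. (u / 2 - u\<^sup>2 / 2) / real k) 0"
    by (rule set_integral_frac_FTC) (use k in \<open>auto intro!: derivative_eq_intros simp: field_simps\<close>)
  finally show ?thesis by simp
qed

lemma toy_moment2_interior:
  assumes k: "k > 0" and x: "x \<in> {1 / real k..1 - 1 / real k}"
  shows "toy_moment2 k x = 1 / (6 * (real k)\<^sup>2)"
proof -
  let ?G = "\<lambda>u. (u - 3 * u\<^sup>2 / 2 + u ^ 3) / (3 * (real k)\<^sup>2)"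
  have "((toy_right k t x - x) ^ 3 - (toy_left k t x - x) ^ 3) / (3 * (toy_right k t x - toy_left k t x)) =
    (1 - 3 * frac (real k * x + t) + 3 * (frac (real k * x + t))\<^sup>2) / (3 * (real k)\<^sup>2)" for t
  proof -
    define u where "u = frac (real k * x + t)"
    have lr: "toy_left k t x - x = - u / real k" "toy_right k t x - x = (1 - u) / real k"
      "toy_right k t x - toy_left k t x = 1 / real k"
      using k unfolding toy_cell_interior[OF k x] u_def by (auto simp: field_simps)
    show ?thesis
      using k unfolding lr u_def[symmetric] by (simp add: field_simps power2_eq_square power3_eq_cube)
  qed
  then have "toy_moment2 k x =
    (LBINT t:{0..<1}. (\<lambda>u. (1 - 3 * u + 3 * u\<^sup>2) / (3 * (real k)\<^sup>2)) (frac (real k * x + t)))"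
    unfolding toy_moment2_def by simp
  also have "\<dots> = ?G 1 - ?G 0"
    by (rule set_integral_frac_FTC) (use k in \<open>auto intro!: derivative_eq_intros simp: field_simps\<close>)
  also have "\<dots> = 1 / (6 * (real k)\<^sup>2)"
    by simp
  finally show ?thesis .
qed

text \<open>Within distance \<open>1/k\<close> of an end point, \<open>x\<close> lies in one of the two cells next to it, and the outermost
  cell is truncated. This makes the first moment positive at the left end and negative at the right end.\<close>

lemma toy_moment1_left:
  assumes k: "k \<ge> 2" and x: "0 < x" "x < 1 / real k"
  shows "toy_moment1 k x = (1 - real k * x)\<^sup>2 / (4 * real k)"
proof -
  define v where "v = real k * x"
  have v: "0 < v" "v < 1" and xv: "x = v / real k"
    using k x by (auto simp: v_def field_simps)
  have k0: "real k > 0" and k2: "2 \<le> real k"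
    using k by simp_all
  \<comment> \<open>The cell of \<open>x\<close> is the first one, \<open>[0, (1 - t) / k)\<close>, or the second one, according as \<open>t < 1 - v\<close> or not.\<close>
  have 1: "(toy_left k t x + toy_right k t x) / 2 - x = ((1 - t) / 2 - v) / real k" if "0 \<le> t" "t < 1 - v" for t
  proof -
    have "\<lfloor>real k * x + t\<rfloor> = 0"
      using that v by (intro floor_unique) (auto simp: v_def[symmetric])
    then have "toy_left k t x = 0" "toy_right k t x = (1 - t) / real k"
      using that k2 v by (auto simp: toy_left_def toy_right_def max_def min_def divide_simps)
    then show ?thesis
      using k0 by (simp add: xv field_simps)
  qed
  have 2: "(toy_left k t x + toy_right k t x) / 2 - x = (3 / 2 - t - v) / real k" if "1 - v \<le> t" "t < 1" for t
  proof -
    have "\<lfloor>real k * x + t\<rfloor> = 1"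
      using that v by (intro floor_unique) (auto simp: v_def[symmetric])
    then have "toy_left k t x = (1 - t) / real k" "toy_right k t x = (2 - t) / real k"
      using that k2 v by (auto simp: toy_left_def toy_right_def max_def min_def divide_simps)
    then show ?thesis
      using k0 by (simp add: xv field_simps)
  qed
  let ?P = "\<lambda>t. (t / 2 - t\<^sup>2 / 4 - v * t) / real k" and ?Q = "\<lambda>t. (3 / 2 * t - t\<^sup>2 / 2 - v * t) / real k"
  have "toy_moment1 k x = ?P (1 - v) - ?P 0 + (?Q 1 - ?Q (1 - v))"
    unfolding toy_moment1_def
    by (rule set_integral_two_pieces_FTC[OF _ _ _ _ _ _ 1 2])
      (use v k0 in \<open>auto intro!: derivative_eq_intros simp: field_simps\<close>)
  also have "\<dots> = (1 - v)\<^sup>2 / (4 * real k)"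
    using k0 by (simp add: field_simps power2_eq_square)
  finally show ?thesis by (simp add: v_def)
qed

lemma toy_moment1_right:
  assumes k: "k \<ge> 2" and x: "1 - 1 / real k < x" "x < 1"
  shows "toy_moment1 k x = - ((1 - real k * (1 - x))\<^sup>2 / (4 * real k))"
proof -
  define w where "w = real k * (1 - x)"
  have w: "0 < w" "w < 1" and xw: "x = 1 - w / real k" and kx: "real k * x = real k - w"
    using k x by (auto simp: w_def field_simps)
  have k0: "real k > 0" and k2: "2 \<le> real k"
    using k by simp_all
  \<comment> \<open>The cell of \<open>x\<close> is the last but one or, if \<open>w \<le> t\<close>, the last one, \<open>[(k - t) / k, 1)\<close>.\<close>
  have 1: "(toy_left k t x + toy_right k t x) / 2 - x = (w - t - 1 / 2) / real k" if "0 \<le> t" "t < w" for t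
  proof -
    have "\<lfloor>real k * x + t\<rfloor> = int k - 1"
      using that w by (intro floor_unique) (auto simp: kx)
    then have "toy_left k t x = (real k - 1 - t) / real k" "toy_right k t x = (real k - t) / real k"
      using that k2 w by (auto simp: toy_left_def toy_right_def max_def min_def divide_simps)
    then show ?thesis
      using k0 by (simp add: xw field_simps)
  qed
  have 2: "(toy_left k t x + toy_right k t x) / 2 - x = (w - t / 2) / real k" if "w \<le> t" "t < 1" for t
  proof -
    have "\<lfloor>real k * x + t\<rfloor> = int k"
      using that w by (intro floor_unique) (auto simp: kx)
    then have "toy_left k t x = (real k - t) / real k" "toy_right k t x = 1"
      using that k2 w by (auto simp: toy_left_def toy_right_def max_def min_def divide_simps)
    then show ?thesis
      using k0 by (simp add: xw field_simps)
  qed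
  let ?P = "\<lambda>t. (w * t - t\<^sup>2 / 2 - t / 2) / real k" and ?Q = "\<lambda>t. (w * t - t\<^sup>2 / 4) / real k"
  have "toy_moment1 k x = ?P w - ?P 0 + (?Q 1 - ?Q w)"
    unfolding toy_moment1_def
    by (rule set_integral_two_pieces_FTC[OF _ _ _ _ _ _ 1 2])
      (use w k0 in \<open>auto intro!: derivative_eq_intros simp: field_simps\<close>)
  also have "\<dots> = - ((1 - w)\<^sup>2 / (4 * real k))"
    using k0 by (simp add: field_simps power2_eq_square)
  finally show ?thesis by (simp add: w_def)
qed

text \<open>The mean of \<open>(y - x)\<^sup>2\<close> over \<open>[l,r)\<close> is at most the squared length.\<close>

lemma second_moment_bounds:
  fixes l r x \<delta> :: real
  assumes "l \<le> x" "x < r" "r - l \<le> \<delta>"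
  shows "0 \<le> ((r - x) ^ 3 - (l - x) ^ 3) / (3 * (r - l))"
    "((r - x) ^ 3 - (l - x) ^ 3) / (3 * (r - l)) \<le> \<delta>\<^sup>2"
proof -
  define a b where "a = x - l" and "b = r - x"
  have ab: "0 \<le> a" "0 < b" "a + b \<le> \<delta>"
    using assms by (auto simp: a_def b_def)
  have lr: "r - x = b" "l - x = - a" "r - l = a + b"
    by (auto simp: a_def b_def)
  have q: "((r - x) ^ 3 - (l - x) ^ 3) / (3 * (r - l)) = (a\<^sup>2 - a * b + b\<^sup>2) / 3" (is "?q = _")
    unfolding lr using ab by (simp add: field_simps power2_eq_square power3_eq_cube)
  have "0 \<le> (a - b)\<^sup>2" "0 \<le> a * b" "(a + b)\<^sup>2 \<le> \<delta>\<^sup>2"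
    using ab by (auto intro: power_mono)
  then have "0 \<le> (a\<^sup>2 - a * b + b\<^sup>2) / 3" "(a\<^sup>2 - a * b + b\<^sup>2) / 3 \<le> \<delta>\<^sup>2"
    by (auto simp: power2_eq_square algebra_simps)
  then show "0 \<le> ?q" "?q \<le> \<delta>\<^sup>2"
    unfolding q by auto
qed

lemma
  assumes k: "k > 0" and x: "x \<in> {0..<1}"
  shows set_integrable_toy_moment1:
      "set_integrable lborel {0..<1} (\<lambda>t. (toy_left k t x + toy_right k t x) / 2 - x)"
    and set_integrable_toy_moment2:
      "set_integrable lborel {0..<1} (\<lambda>t. ((toy_right k t x - x) ^ 3 - (toy_left k t x - x) ^ 3)
        / (3 * (toy_right k t x - toy_left k t x)))"
    and toy_moment2_bounds: "0 \<le> toy_moment2 k x" "toy_moment2 k x \<le> 1 / (real k)\<^sup>2"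
proof -
  show "set_integrable lborel {0..<1} (\<lambda>t. (toy_left k t x + toy_right k t x) / 2 - x)"
  proof (rule set_integrable_unit_interval[where B = 1])
    show "set_borel_measurable borel {0..<1} (\<lambda>t. (toy_left k t x + toy_right k t x) / 2 - x)"
      unfolding set_borel_measurable_def by measurable
    show "\<bar>(toy_left k t x + toy_right k t x) / 2 - x\<bar> \<le> 1" if "t \<in> {0..<1}" for t
      using toy_cell_bounds[OF k that x] by (simp add: abs_le_iff field_simps)
  qed auto
  have b: "0 \<le> ((toy_right k t x - x) ^ 3 - (toy_left k t x - x) ^ 3) / (3 * (toy_right k t x - toy_left k t x))"
    "((toy_right k t x - x) ^ 3 - (toy_left k t x - x) ^ 3) / (3 * (toy_right k t x - toy_left k t x))
      \<le> (1 / real k)\<^sup>2" if "t \<in> {0..<1}" for t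
    using second_moment_bounds[OF toy_cell_bounds(2,3,5)[OF k that x]] .
  show int: "set_integrable lborel {0..<1} (\<lambda>t. ((toy_right k t x - x) ^ 3 - (toy_left k t x - x) ^ 3)
        / (3 * (toy_right k t x - toy_left k t x)))"
  proof (rule set_integrable_unit_interval[where B = "(1 / real k)\<^sup>2"])
    show "set_borel_measurable borel {0..<1} (\<lambda>t. ((toy_right k t x - x) ^ 3 - (toy_left k t x - x) ^ 3)
        / (3 * (toy_right k t x - toy_left k t x)))"
      unfolding set_borel_measurable_def by measurable
    show "\<bar>((toy_right k t x - x) ^ 3 - (toy_left k t x - x) ^ 3) / (3 * (toy_right k t x - toy_left k t x))\<bar>
        \<le> (1 / real k)\<^sup>2" if "t \<in> {0..<1}" for t
      using b[OF that] by (simp only: abs_of_nonneg)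
  qed auto
  have "toy_moment2 k x \<le> (LBINT t:{0..<1::real}. (1 / real k)\<^sup>2)"
    unfolding toy_moment2_def using b int
    by (intro set_integral_mono) (auto simp: set_integrable_def)
  then show "toy_moment2 k x \<le> 1 / (real k)\<^sup>2"
    by (simp add: set_lebesgue_integral_def power_divide)
  show "0 \<le> toy_moment2 k x"
    unfolding toy_moment2_def set_lebesgue_integral_def
    using b by (intro Bochner_Integration.integral_nonneg) (auto simp: indicator_def)
qed

section \<open>Functions with a cubic Taylor remainder\<close>

text \<open>A function with two derivatives on \<open>[0,1)\<close> whose second-order Taylor expansion has a uniform cubic
  error. At \<open>0\<close> the derivatives are one-sided.\<close>

locale cubic_taylor =
  fixes s s' s'' :: "real \<Rightarrow> real" and C :: real
  assumes has_derivative: "\<And>x. x \<in> {0..<1} \<Longrightarrow> (s has_real_derivative s' x) (at x within {0..<1})"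
    and has_second_derivative: "\<And>x. x \<in> {0..<1} \<Longrightarrow> (s' has_real_derivative s'' x) (at x within {0..<1})"
    and C_pos: "C > 0"
    and taylor: "\<And>t x. t \<in> {0..<1} \<Longrightarrow> x \<in> {0..<1} \<Longrightarrow>
      \<bar>s t - s x - s' x * (t - x) - 1/2 * s'' x * (t - x)\<^sup>2\<bar> \<le> C * \<bar>t - x\<bar> ^ 3"
begin

lemma continuous_on_s: "continuous_on {0..<1} s" and continuous_on_s': "continuous_on {0..<1} s'"
  using has_derivative has_second_derivative by (blast intro: DERIV_continuous_on)+

text \<open>The second difference with step \<open>h\<close> of the Taylor polynomial at any point \<open>z\<close> is \<open>s'' z * h\<^sup>2\<close>. The
  polynomials at \<open>x\<close> and at \<open>y\<close> both approximate \<open>s\<close> at \<open>x\<close>, \<open>(x + y) / 2\<close> and \<open>y\<close>, so their second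
  differences over these three points are close to each other.\<close>

lemma lipschitz_s'':
  assumes "x \<in> {0..<1}" "y \<in> {0..<1}"
  shows "\<bar>s'' x - s'' y\<bar> \<le> 10 * C * \<bar>x - y\<bar>"
  using assms
proof (induction x y rule: linorder_wlog)
  case (le x y)
  show ?case
  proof (cases "x = y")
    case False
    \<comment> \<open>The three points are \<open>x\<close>, \<open>x + h\<close>, \<open>x + 2 * h = y\<close>, with second-difference weights \<open>1, -2, 1\<close>.\<close>
    define h where "h = (y - x) / 2"
    have h: "h > 0" and y: "y = x + 2 * h"
      using False le by (auto simp: h_def field_simps)
    have dom: "x \<in> {0..<1}" "x + h \<in> {0..<1}" "x + 2 * h \<in> {0..<1}"
      using le h y by auto
    define P where "P z t = s z + s' z * (t - z) + 1/2 * s'' z * (t - z)\<^sup>2" for z t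
    have P: "\<bar>s t - P z t\<bar> \<le> C * \<bar>t - z\<bar> ^ 3" if "t \<in> {0..<1}" "z \<in> {0..<1}" for t z
      using taylor[OF that] by (simp add: P_def algebra_simps)
    have second_difference: "P z x - 2 * P z (x + h) + P z (x + 2 * h) = s'' z * h\<^sup>2" for z
      by (simp add: P_def algebra_simps power2_eq_square)
    have diff: "\<bar>P x t - P y t\<bar> \<le> C * \<bar>t - x\<bar> ^ 3 + C * \<bar>t - y\<bar> ^ 3" if "t \<in> {0..<1}" for t
      using P[OF that, of x] P[OF that, of y] le by (simp add: abs_le_iff)
    have tri: "\<bar>a - 2 * b + c\<bar> \<le> \<bar>a\<bar> + 2 * \<bar>b\<bar> + \<bar>c\<bar>" for a b c :: real
      by linarith
    have "(s'' x - s'' y) * h\<^sup>2 =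
      (P x x - P y x) - 2 * (P x (x + h) - P y (x + h)) + (P x (x + 2 * h) - P y (x + 2 * h))"
      using second_difference[of x] second_difference[of y] by (simp add: algebra_simps)
    also have "\<bar>\<dots>\<bar> \<le> \<bar>P x x - P y x\<bar> + 2 * \<bar>P x (x + h) - P y (x + h)\<bar> + \<bar>P x (x + 2 * h) - P y (x + 2 * h)\<bar>"
      by (rule tri)
    also have "\<dots> \<le> C * (2 * h) ^ 3 + 2 * (C * h ^ 3 + C * h ^ 3) + C * (2 * h) ^ 3"
      using diff[OF dom(1)] diff[OF dom(2)] diff[OF dom(3)] h unfolding y by simp
    also have "\<dots> = 10 * C * (2 * h) * h\<^sup>2"
      by (simp add: power2_eq_square power3_eq_cube)
    finally have "\<bar>s'' x - s'' y\<bar> * h\<^sup>2 \<le> 10 * C * (2 * h) * h\<^sup>2"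
      by (simp add: abs_mult)
    then have "\<bar>s'' x - s'' y\<bar> \<le> 10 * C * (2 * h)"
      using h by (simp add: mult_le_cancel_right)
    then show ?thesis
      using h by (simp add: y)
  qed simp
qed (simp add: abs_minus_commute)

lemma continuous_on_s'': "continuous_on {0..<1} s''"
proof (rule lipschitz_on_continuous_on[where L = "10 * C"])
  show "(10 * C)-lipschitz_on {0..<1} s''"
    using lipschitz_s'' C_pos by (intro lipschitz_onI) (auto simp: dist_real_def)
qed

lemma set_borel_measurable_s: "set_borel_measurable borel {0..<1} s"
  unfolding set_borel_measurable_def
  using continuous_on_s by (intro borel_measurable_continuous_on_indicator) auto

lemma bounded_s: "\<exists>B. \<forall>x\<in>{0..<1}. \<bar>s x\<bar> \<le> B"
proof (intro exI ballI)
  fix x :: real assume x: "x \<in> {0..<1}"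
  have bound: "\<bar>y\<bar> \<le> \<bar>a\<bar> + \<bar>b\<bar> + \<bar>c\<bar> + e"
    if "\<bar>y - a - b' - 1/2 * c'\<bar> \<le> e" "\<bar>b'\<bar> \<le> \<bar>b\<bar>" "\<bar>c'\<bar> \<le> \<bar>c\<bar>" for y a b b' c c' e :: real
    using that by linarith
  have "\<bar>s' 0 * x\<bar> \<le> \<bar>s' 0\<bar>" "\<bar>s'' 0 * x\<^sup>2\<bar> \<le> \<bar>s'' 0\<bar>" "C * \<bar>x\<bar> ^ 3 \<le> C"
    using x C_pos by (auto simp: abs_mult mult_left_le power_le_one)
  moreover have "\<bar>s x - s 0 - s' 0 * x - 1/2 * (s'' 0 * x\<^sup>2)\<bar> \<le> C * \<bar>x\<bar> ^ 3"
    using taylor[OF x, of 0] by simp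
  ultimately show "\<bar>s x\<bar> \<le> \<bar>s 0\<bar> + \<bar>s' 0\<bar> + \<bar>s'' 0\<bar> + C"
    by (intro bound) (auto intro: order_trans)
qed

lemma bounded_s'': "\<exists>B. \<forall>x\<in>{0..<1}. \<bar>s'' x\<bar> \<le> B"
proof (intro exI ballI)
  fix x :: real assume x: "x \<in> {0..<1}"
  have "10 * C * \<bar>x\<bar> \<le> 10 * C"
    using x C_pos by simp
  then show "\<bar>s'' x\<bar> \<le> \<bar>s'' 0\<bar> + 10 * C"
    using lipschitz_s''[OF x, of 0] by simp
qed

text \<open>From every \<open>x\<close> one can move by \<open>1/2\<close> to one of the two sides without leaving \<open>[0,1)\<close>; the expansion
  along this step bounds \<open>s' x\<close> in terms of \<open>s\<close> and \<open>s''\<close>.\<close>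

lemma bounded_s': "\<exists>B. \<forall>x\<in>{0..<1}. \<bar>s' x\<bar> \<le> B"
proof -
  obtain B where B: "\<And>x. x \<in> {0..<1} \<Longrightarrow> \<bar>s x\<bar> \<le> B"
    using bounded_s by blast
  obtain B'' where B'': "\<And>x. x \<in> {0..<1} \<Longrightarrow> \<bar>s'' x\<bar> \<le> B''"
    using bounded_s'' by blast
  have "\<bar>s' x\<bar> \<le> 4 * B + B'' + C" if x: "x \<in> {0..<1}" for x
  proof -
    obtain h where e: "\<bar>h\<bar> = 1/2" "h\<^sup>2 = 1/4" and t: "x + h \<in> {0..<1}"
    proof (cases "x < 1/2")
      case True
      with x that[of "1/2"] show thesis by (auto simp: power2_eq_square)
    next
      case False
      with x that[of "-1/2"] show thesis by (auto simp: power2_eq_square)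
    qed
    have "\<bar>s' x\<bar> / 2 = \<bar>s' x * h\<bar>"
      using e by (simp add: abs_mult)
    also have "\<dots> \<le> \<bar>s (x + h)\<bar> + \<bar>s x\<bar> + \<bar>s'' x\<bar> / 8 + C / 8"
    proof -
      have bound: "\<bar>b\<bar> \<le> \<bar>y\<bar> + \<bar>a\<bar> + \<bar>c\<bar> / 8 + e / 8"
        if "\<bar>y - a - b - 1/8 * c\<bar> \<le> e / 8" for y a b c e :: real
        using that by linarith
      have "\<bar>s (x + h) - s x - s' x * h - 1/8 * s'' x\<bar> \<le> C / 8"
        using taylor[OF t x] e by (simp add: power_divide)
      then show ?thesis by (rule bound)
    qed
    also have "\<dots> \<le> B + B + B'' / 8 + C / 8"
      using B[OF t] B[OF x] B''[OF x] by simp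
    also have "\<dots> \<le> (4 * B + B'' + C) / 2"
      using C_pos B''[OF x] by simp
    finally show ?thesis by simp
  qed
  then show ?thesis by blast
qed

text \<open>Boundedness is what makes \<^const>\<open>sup_norm\<close> an upper bound: a supremum of an unbounded set of reals
  is an arbitrary number.\<close>

lemma
  shows abs_s'_le: "\<And>x. x \<in> {0..<1} \<Longrightarrow> \<bar>s' x\<bar> \<le> sup_norm s'"
    and abs_s''_le: "\<And>x. x \<in> {0..<1} \<Longrightarrow> \<bar>s'' x\<bar> \<le> sup_norm s''"
  using bounded_s' bounded_s'' unfolding sup_norm_def
  by (auto intro!: cSUP_upper bdd_aboveI2)

lemma sup_norm_nonneg: "0 \<le> sup_norm s'" "0 \<le> sup_norm s''"
  using abs_s'_le[of 0] abs_s''_le[of 0] by auto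

section \<open>Pointwise estimates\<close>

lemma average_taylor:
  assumes l: "0 \<le> l" "l \<le> x" and r: "x < r" "r \<le> 1" and \<delta>: "r - l \<le> \<delta>"
  shows "\<bar>average s l r - (s x + s' x * ((l + r) / 2 - x)
    + s'' x / 2 * (((r - x) ^ 3 - (l - x) ^ 3) / (3 * (r - l))))\<bar> \<le> C * \<delta> ^ 3"
proof -
  \<comment> \<open>The Taylor polynomial at \<open>x\<close> and an antiderivative of it.\<close>
  let ?p = "\<lambda>y. s x + s' x * (y - x) + 1/2 * s'' x * (y - x)\<^sup>2"
  let ?P = "\<lambda>y. s x * y + s' x * (y - x)\<^sup>2 / 2 + s'' x / 2 * (y - x) ^ 3 / 3"
  have x: "x \<in> {0..<1}" and lr: "l \<le> r"
    using assms by auto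
  have P: "(?P has_real_derivative ?p y) (at y)" for y
    by (auto intro!: derivative_eq_intros simp: field_simps)
  have cont: "isCont ?p y" for y
    by simp
  note p_int = set_integrable_half_open_FTC[OF lr P cont]
  note p_eq = set_integral_half_open_FTC[OF lr P cont]
  obtain B where B: "\<And>x. x \<in> {0..<1} \<Longrightarrow> \<bar>s x\<bar> \<le> B"
    using bounded_s by blast
  have s_int: "set_integrable lborel {l..<r} s"
  proof (rule set_integrable_unit_interval[OF _ B])
    show "set_borel_measurable borel {0..<1} s"
      by (rule set_borel_measurable_s)
  qed (use l r in auto)
  have divide: "\<bar>a / w - b / w\<bar> \<le> c" if "\<bar>a - b\<bar> \<le> c * w" "w > 0" for a b c w :: real
  proof -
    have "\<bar>a / w - b / w\<bar> = \<bar>a - b\<bar> / w"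
      using that(2) by (simp add: abs_divide flip: diff_divide_distrib)
    also have "\<dots> \<le> c"
      using that by (simp add: pos_divide_le_eq)
    finally show ?thesis .
  qed
  have "\<bar>(LBINT y:{l..<r}. s y) - (LBINT y:{l..<r}. ?p y)\<bar> \<le> C * \<delta> ^ 3 * measure lborel {l..<r}"
  proof (rule set_integral_diff_le[OF s_int p_int _ _ finite.emptyI])
    fix y assume y: "y \<in> {l..<r} - {}"
    have "\<bar>s y - ?p y\<bar> \<le> C * \<bar>y - x\<bar> ^ 3"
      using taylor[of y x] y x l r by (simp add: algebra_simps)
    also have "\<dots> \<le> C * \<delta> ^ 3"
      using y l r \<delta> C_pos by (intro mult_left_mono power_mono) auto
    finally show "\<bar>s y - ?p y\<bar> \<le> C * \<delta> ^ 3" .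
  qed (use lr in auto)
  also have "(LBINT y:{l..<r}. ?p y) = ?P r - ?P l"
    by (rule p_eq)
  finally have "\<bar>(LBINT y:{l..<r}. s y) - (?P r - ?P l)\<bar> \<le> C * \<delta> ^ 3 * (r - l)"
    using lr by simp
  then have "\<bar>average s l r - (?P r - ?P l) / (r - l)\<bar> \<le> C * \<delta> ^ 3"
    unfolding average_def by (rule divide) (use l r in simp)
  moreover have "(?P r - ?P l) / (r - l) = s x + s' x * ((l + r) / 2 - x)
    + s'' x / 2 * (((r - x) ^ 3 - (l - x) ^ 3) / (3 * (r - l)))"
    using l r by (simp add: divide_simps) (simp add: algebra_simps power2_eq_square power3_eq_cube)
  ultimately show ?thesis by simp
qed

text \<open>Averaging the previous lemma over the random cell: up to the cubic error, the expected cell average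
  depends on the partition only through the two moments.\<close>

lemma toy_mean_estimate:
  assumes k: "k > 0" and x: "x \<in> {0..<1}"
  shows "\<bar>toy_mean s k x - (s x + s' x * toy_moment1 k x + s'' x / 2 * toy_moment2 k x)\<bar> \<le> C * (1 / real k) ^ 3"
proof -
  let ?m1 = "\<lambda>t. (toy_left k t x + toy_right k t x) / 2 - x"
  let ?m2 = "\<lambda>t. ((toy_right k t x - x) ^ 3 - (toy_left k t x - x) ^ 3) / (3 * (toy_right k t x - toy_left k t x))"
  let ?g = "\<lambda>t. s x + s' x * ?m1 t + s'' x / 2 * ?m2 t"
  obtain B where B: "\<And>x. x \<in> {0..<1} \<Longrightarrow> \<bar>s x\<bar> \<le> B"
    using bounded_s by blast
  have c: "set_integrable lborel {0..<1} (\<lambda>t::real. s x)"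
    by (simp add: set_integrable_def)
  have m1: "set_integrable lborel {0..<1} (\<lambda>t. s' x * ?m1 t)"
    by (rule set_integrable_mult_right) (rule set_integrable_toy_moment1[OF k x])
  have m2: "set_integrable lborel {0..<1} (\<lambda>t. s'' x / 2 * ?m2 t)"
    by (rule set_integrable_mult_right) (rule set_integrable_toy_moment2[OF k x])
  note cm1 = set_integral_add(1)[OF c m1]
  have "(LBINT t:{0..<1}. ?g t) = (LBINT t:{0..<1::real}. s x) + (LBINT t:{0..<1}. s' x * ?m1 t)
      + (LBINT t:{0..<1}. s'' x / 2 * ?m2 t)"
    unfolding set_integral_add(2)[OF cm1 m2] set_integral_add(2)[OF c m1] ..
  also have "\<dots> = s x + s' x * toy_moment1 k x + s'' x / 2 * toy_moment2 k x"
    unfolding toy_moment1_def toy_moment2_def set_integral_mult_right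
    by (simp add: set_lebesgue_integral_def)
  finally have g: "(LBINT t:{0..<1}. ?g t) = s x + s' x * toy_moment1 k x + s'' x / 2 * toy_moment2 k x" .
  have "\<bar>toy_mean s k x - (LBINT t:{0..<1}. ?g t)\<bar> \<le> C * (1 / real k) ^ 3 * measure lborel {0..<1::real}"
    unfolding toy_mean_def
  proof (rule set_integral_diff_le[OF set_integrable_toy_average[OF set_borel_measurable_s B k x]
        set_integral_add(1)[OF cm1 m2] _ _ finite.emptyI])
    show "\<bar>average s (toy_left k t x) (toy_right k t x) - ?g t\<bar> \<le> C * (1 / real k) ^ 3"
      if "t \<in> {0..<1} - {}" for t
      using average_taylor[OF toy_cell_bounds[OF k _ x, of t]] that by simp
  qed auto
  then show ?thesis
    unfolding g by simp
qed

text \<open>The first moment vanishes, so the error is \<open>s'' x / (12 k\<^sup>2)\<close> up to \<open>C / k\<^sup>3\<close>.\<close>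

lemma squared_error_interior:
  assumes k: "k \<ge> 2" and x: "x \<in> {1 / real k..1 - 1 / real k}"
  shows "\<bar>(toy_mean s k x - s x)\<^sup>2 - (s'' x)\<^sup>2 / (144 * real k ^ 4)\<bar>
      \<le> 3 * C * (sup_norm s'' + 3 * C / 2) / (4 * real k ^ 5)"
    and "(toy_mean s k x - s x)\<^sup>2 \<le> (sup_norm s'' / 12 + C / 2)\<^sup>2 / real k ^ 4"
proof -
  define d where "d = 1 / real k"
  have d: "0 < d" "d \<le> 1 / 2" and k0: "k > 0"
    using k by (auto simp: d_def field_simps)
  have x01: "x \<in> {0..<1}"
    using x d by (auto simp: d_def[symmetric])
  \<comment> \<open>The leading term of the error.\<close>
  let ?b = "s'' x / 12 * d\<^sup>2"
  have m: "toy_moment1 k x = 0" "toy_moment2 k x = d\<^sup>2 / 6"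
    using toy_moment1_interior[OF k0 x] toy_moment2_interior[OF k0 x] by (auto simp: d_def power_divide)
  have err: "\<bar>(toy_mean s k x - s x) - ?b\<bar> \<le> C * d ^ 3"
    using toy_mean_estimate[OF k0 x01] unfolding m d_def[symmetric] by (simp add: algebra_simps)
  have b: "\<bar>?b\<bar> \<le> sup_norm s'' / 12 * d\<^sup>2"
    using abs_s''_le[OF x01] by (simp add: abs_mult mult_right_mono)
  have "\<bar>(toy_mean s k x - s x)\<^sup>2 - ?b\<^sup>2\<bar> \<le> C * d ^ 3 * (C * d ^ 3 + 2 * (sup_norm s'' / 12 * d\<^sup>2))"
    by (rule abs_diff_squares_le[OF err b])
  also have "\<dots> = C * d ^ 5 * (C * d + sup_norm s'' / 6)"
    by (simp add: algebra_simps eval_nat_numeral)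
  also have "\<dots> \<le> C * d ^ 5 * (3 / 4 * (sup_norm s'' + 3 * C / 2))"
  proof (rule mult_left_mono)
    have "C * d \<le> C * (1 / 2)"
      using d C_pos by (intro mult_left_mono) auto
    then have "C * d + sup_norm s'' / 6 \<le> 3 / 4 * sup_norm s'' + 9 / 8 * C"
      using C_pos sup_norm_nonneg(2) by linarith
    then show "C * d + sup_norm s'' / 6 \<le> 3 / 4 * (sup_norm s'' + 3 * C / 2)"
      by (simp add: algebra_simps)
  qed (use C_pos d in simp)
  also have "\<dots> = 3 * C * (sup_norm s'' + 3 * C / 2) / (4 * real k ^ 5)"
    by (simp add: d_def power_divide field_simps)
  also have "?b\<^sup>2 = (s'' x)\<^sup>2 / (144 * real k ^ 4)"
    by (simp add: d_def power_divide power_mult_distrib)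
  finally show "\<bar>(toy_mean s k x - s x)\<^sup>2 - (s'' x)\<^sup>2 / (144 * real k ^ 4)\<bar>
      \<le> 3 * C * (sup_norm s'' + 3 * C / 2) / (4 * real k ^ 5)" .
  have "\<bar>toy_mean s k x - s x\<bar> \<le> \<bar>(toy_mean s k x - s x) - ?b\<bar> + \<bar>?b\<bar>"
    by simp
  also have "\<dots> \<le> C * d ^ 3 + sup_norm s'' / 12 * d\<^sup>2"
    by (rule add_mono[OF err b])
  also have "\<dots> = (sup_norm s'' / 12 + C * d) * d\<^sup>2"
    by (simp add: algebra_simps power2_eq_square power3_eq_cube)
  also have "\<dots> \<le> (sup_norm s'' / 12 + C * (1 / 2)) * d\<^sup>2"
    using d C_pos by (intro mult_right_mono add_left_mono mult_left_mono) auto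
  finally have "\<bar>toy_mean s k x - s x\<bar>\<^sup>2 \<le> ((sup_norm s'' / 12 + C * (1 / 2)) * d\<^sup>2)\<^sup>2"
    by (rule power_mono) simp
  then show "(toy_mean s k x - s x)\<^sup>2 \<le> (sup_norm s'' / 12 + C / 2)\<^sup>2 / real k ^ 4"
    by (simp add: d_def power_divide power_mult_distrib)
qed

text \<open>The main term comes from the first moment. The constants are smaller than those of the pointwise bound in the
  theorem: with \<open>(sup_norm s'')\<^sup>2\<close> in place of \<open>(sup_norm s'')\<^sup>2 / 2\<close>, the two strips near the end points
  would use up the whole term \<open>(sup_norm s'')\<^sup>2\<close> of the integrated bound, and the interior contributes
  another \<open>(sup_norm s'')\<^sup>2 / (144 k\<^sup>4)\<close>.\<close>

lemma squared_error_boundary: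
  assumes k: "k \<ge> 2" and x: "0 < x" "x < 1" "x < 1 / real k \<or> 1 - 1 / real k < x"
  shows "\<bar>(toy_mean s k x - s x)\<^sup>2 - (s' x)\<^sup>2 * (1 - real k * min x (1 - x)) ^ 4 / (16 * (real k)\<^sup>2)\<bar>
    \<le> (sup_norm s' * sup_norm s'' + C * sup_norm s' + (sup_norm s'')\<^sup>2 / 2
        + C * sup_norm s'' + C\<^sup>2 / 2) / (4 * real k ^ 3)"
proof -
  define d where "d = 1 / real k"
  have d: "0 < d" "d \<le> 1 / 2" and k0: "k > 0"
    using k by (auto simp: d_def field_simps)
  have kd: "real k * d = 1"
    using k0 by (simp add: d_def)
  have x01: "x \<in> {0..<1}"
    using x by auto
  let ?S1 = "sup_norm s'" and ?S2 = "sup_norm s''"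
  let ?v = "1 - real k * min x (1 - x)"
  \<comment> \<open>The leading term of the error.\<close>
  let ?b = "s' x * toy_moment1 k x"
  have "real k * min x (1 - x) \<le> real k * d"
    using x k0 by (intro mult_left_mono) (auto simp: d_def[symmetric])
  moreover have "0 \<le> real k * min x (1 - x)"
    using x by simp
  ultimately have v: "0 \<le> ?v" "?v \<le> 1"
    unfolding kd by simp_all
  have m: "\<bar>toy_moment1 k x\<bar> = ?v\<^sup>2 * d / 4"
    using x(3)
  proof
    assume x': "x < 1 / real k"
    then have "min x (1 - x) = x"
      using d by (simp add: d_def[symmetric])
    then show ?thesis
      using toy_moment1_left[OF k x(1) x'] by (simp add: d_def)
  next
    assume x': "1 - 1 / real k < x"
    then have "min x (1 - x) = 1 - x"
      using d by (simp add: d_def[symmetric])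
    then show ?thesis
      using toy_moment1_right[OF k x' x(2)] by (simp add: d_def)
  qed
  have m2: "\<bar>s'' x / 2 * toy_moment2 k x\<bar> \<le> ?S2 / 2 * d\<^sup>2"
    unfolding abs_mult using abs_s''_le[OF x01] toy_moment2_bounds[OF k0 x01]
    by (intro mult_mono) (auto simp: d_def power_divide)
  have tri: "\<bar>a - b - p\<bar> \<le> f + e" if "\<bar>q\<bar> \<le> f" "\<bar>a - (b + p + q)\<bar> \<le> e" for a b p q e f :: real
    using that by linarith
  have err: "\<bar>(toy_mean s k x - s x) - ?b\<bar> \<le> ?S2 / 2 * d\<^sup>2 + C * d ^ 3"
    by (rule tri[OF m2 toy_mean_estimate[OF k0 x01, folded d_def]])
  have b: "\<bar>?b\<bar> \<le> ?S1 * (d / 4)"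
    unfolding abs_mult m using abs_s'_le[OF x01] v d power_le_one[OF v, of 2]
    by (intro mult_mono) auto
  have "\<bar>(toy_mean s k x - s x)\<^sup>2 - ?b\<^sup>2\<bar>
      \<le> (?S2 / 2 * d\<^sup>2 + C * d ^ 3) * ((?S2 / 2 * d\<^sup>2 + C * d ^ 3) + 2 * (?S1 * (d / 4)))"
    by (rule abs_diff_squares_le[OF err b])
  \<comment> \<open>In this form every power of \<open>2 * d \<le> 1\<close> can be dropped.\<close>
  also have "\<dots> = d ^ 3 / 4 * (?S1 * ?S2 + (2 * d) * (C * ?S1) + (2 * d) * (?S2\<^sup>2 / 2)
      + (2 * d)\<^sup>2 * (C * ?S2) + (2 * d) ^ 3 * (C\<^sup>2 / 2))"
    by (simp add: algebra_simps power2_eq_square power3_eq_cube)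
  also have "\<dots> \<le> d ^ 3 / 4 * (?S1 * ?S2 + C * ?S1 + ?S2\<^sup>2 / 2 + C * ?S2 + C\<^sup>2 / 2)"
    using d C_pos sup_norm_nonneg
    by (intro mult_left_mono add_mono mult_left_le_one_le power_le_one) auto
  also have "\<dots> = (?S1 * ?S2 + C * ?S1 + ?S2\<^sup>2 / 2 + C * ?S2 + C\<^sup>2 / 2) / (4 * real k ^ 3)"
    by (simp add: d_def power_divide)
  also have "?b\<^sup>2 = (s' x)\<^sup>2 * \<bar>toy_moment1 k x\<bar>\<^sup>2"
    by (simp add: power_mult_distrib)
  also have "\<dots> = (s' x)\<^sup>2 * ?v ^ 4 / (16 * (real k)\<^sup>2)"
  proof -
    have "(?v\<^sup>2 * d / 4)\<^sup>2 = ?v ^ 4 * d\<^sup>2 / 16"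
      by (simp only: power_mult_distrib power_divide power_mult[symmetric]) simp
    then show ?thesis
      unfolding m by (simp add: d_def power_divide)
  qed
  finally show ?thesis .
qed

section \<open>Integrated estimates\<close>

lemma set_integrable_squared_error:
  assumes k: "k > 0" and A: "A \<in> sets borel" "A \<subseteq> {0..1}"
  shows "set_integrable lborel A (\<lambda>x. (toy_mean s k x - s x)\<^sup>2)"
proof -
  obtain B where B: "\<And>x. x \<in> {0..<1} \<Longrightarrow> \<bar>s x\<bar> \<le> B"
    using bounded_s by blast
  show ?thesis
  proof (rule set_integrable_unit_interval[OF _ _ A])
    have "(\<lambda>x. (indicator {0..<1} x *\<^sub>R toy_mean s k x - indicator {0..<1} x *\<^sub>R s x)\<^sup>2) \<in> borel_measurable borel"
      using set_borel_measurable_toy_mean[OF set_borel_measurable_s k] set_borel_measurable_s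
      unfolding set_borel_measurable_def by (intro borel_measurable_power borel_measurable_diff)
    also have "(\<lambda>x. (indicator {0..<1} x *\<^sub>R toy_mean s k x - indicator {0..<1} x *\<^sub>R s x)\<^sup>2) =
        (\<lambda>x. indicator {0..<1} x *\<^sub>R (toy_mean s k x - s x)\<^sup>2)"
      by (auto simp: indicator_def)
    finally show "set_borel_measurable borel {0..<1} (\<lambda>x. (toy_mean s k x - s x)\<^sup>2)"
      unfolding set_borel_measurable_def .
    fix x :: real assume x: "x \<in> {0..<1}"
    have "\<bar>toy_mean s k x - s x\<bar> \<le> 2 * B"
      using abs_toy_mean_le[OF set_borel_measurable_s B k x] B[OF x] by linarith
    then have "\<bar>toy_mean s k x - s x\<bar>\<^sup>2 \<le> (2 * B)\<^sup>2"
      by (rule power_mono) simp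
    then show "\<bar>(toy_mean s k x - s x)\<^sup>2\<bar> \<le> (2 * B)\<^sup>2"
      by simp
  qed
qed

lemma set_integrable_weighted_s'_squared:
  assumes w: "continuous_on UNIV w" and A: "A \<in> sets borel" "A \<subseteq> {0..1}"
  shows "set_integrable lborel A (\<lambda>x. (s' x)\<^sup>2 * w x)"
proof -
  have "compact (w ` {0..1})"
    using w by (intro compact_continuous_image continuous_on_subset[OF w]) auto
  then obtain W where W: "\<forall>x\<in>{0..1}. \<bar>w x\<bar> \<le> W"
    by (auto dest!: compact_imp_bounded simp: bounded_iff)
  show ?thesis
  proof (rule set_integrable_unit_interval[OF _ _ A])
    show "set_borel_measurable borel {0..<1} (\<lambda>x. (s' x)\<^sup>2 * w x)"
      unfolding set_borel_measurable_def
      by (intro borel_measurable_continuous_on_indicator continuous_intros continuous_on_s'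
          continuous_on_subset[OF w]) auto
    fix x :: real assume x: "x \<in> {0..<1}"
    have "\<bar>s' x\<bar>\<^sup>2 \<le> (sup_norm s')\<^sup>2"
      using abs_s'_le[OF x] by (intro power_mono) auto
    then show "\<bar>(s' x)\<^sup>2 * w x\<bar> \<le> (sup_norm s')\<^sup>2 * W"
      unfolding abs_mult using W x by (intro mult_mono) auto
  qed
qed

lemma set_integrable_s''_squared:
  assumes A: "A \<in> sets borel" "A \<subseteq> {0..1}"
  shows "set_integrable lborel A (\<lambda>x. (s'' x)\<^sup>2)"
proof (rule set_integrable_unit_interval[OF _ _ A])
  show "set_borel_measurable borel {0..<1} (\<lambda>x. (s'' x)\<^sup>2)"
    unfolding set_borel_measurable_def
    by (intro borel_measurable_continuous_on_indicator continuous_intros continuous_on_s'') auto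
  show "\<bar>(s'' x)\<^sup>2\<bar> \<le> (sup_norm s'')\<^sup>2" if "x \<in> {0..<1}" for x
    using power_mono[OF abs_s''_le[OF that], of 2] by simp
qed

lemma integral_squared_error_interior:
  assumes k: "k \<ge> 2"
  shows "\<bar>(LBINT x:{1 / real k..1 - 1 / real k}. (toy_mean s k x - s x)\<^sup>2)
      - 1 / (144 * real k ^ 4) * (LBINT x:{1 / real k..1 - 1 / real k}. (s'' x)\<^sup>2)\<bar>
    \<le> 3 * C * (sup_norm s'' + 3 * C / 2) / (4 * real k ^ 5)"
proof -
  let ?A = "{1 / real k..1 - 1 / real k}" and ?e = "3 * C * (sup_norm s'' + 3 * C / 2) / (4 * real k ^ 5)"
  have k0: "k > 0" and d: "1 / real k \<le> 1 / 2"
    using k by (auto simp: field_simps)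
  have A: "?A \<in> sets borel" "?A \<subseteq> {0..1}"
    by (auto intro: order_trans[rotated])
  have "\<bar>(LBINT x:?A. (toy_mean s k x - s x)\<^sup>2) - (LBINT x:?A. 1 / (144 * real k ^ 4) * (s'' x)\<^sup>2)\<bar>
      \<le> ?e * measure lborel ?A"
    by (rule set_integral_diff_le[OF set_integrable_squared_error[OF k0 A]
          set_integrable_mult_right[OF set_integrable_s''_squared[OF A]] _ _ finite.emptyI])
      (use squared_error_interior(1)[OF k] d in auto)
  also have "\<dots> \<le> ?e * 1"
    using d C_pos sup_norm_nonneg by (intro mult_left_mono) auto
  finally show ?thesis
    unfolding set_integral_mult_right by simp
qed

text \<open>Two strips of width \<open>1/k\<close> contribute an error of order \<open>k\<^sup>-\<^sup>3 / k\<close> each. The squared error in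
  the interior is of order \<open>k\<^sup>-\<^sup>4\<close>, and all of it is counted as error.\<close>

lemma integral_squared_error:
  assumes k: "k \<ge> 2"
  shows "\<bar>(LBINT x:{0..1}. (toy_mean s k x - s x)\<^sup>2)
      - 1 / (16 * (real k)\<^sup>2) * (LBINT x:{0..1 / real k}. ((s' x)\<^sup>2 + (s' (1 - x))\<^sup>2) * (1 - real k * x) ^ 4)\<bar>
    \<le> (sup_norm s' * sup_norm s'' + 2 * C * sup_norm s' + (sup_norm s'')\<^sup>2
         + 2 * C * sup_norm s'' + 4 * C\<^sup>2) / (2 * real k ^ 4)"
proof -
  define d where "d = 1 / real k"
  have d: "0 < d" "d \<le> 1 / 2" and k0: "k > 0"
    using k by (auto simp: d_def field_simps)
  let ?S1 = "sup_norm s'" and ?S2 = "sup_norm s''"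
  define E where "E = (?S1 * ?S2 + C * ?S1 + ?S2\<^sup>2 / 2 + C * ?S2 + C\<^sup>2 / 2) / (4 * real k ^ 3)"
  define c where "c = 1 / (16 * (real k)\<^sup>2)"
  let ?D = "\<lambda>x. (toy_mean s k x - s x)\<^sup>2"
  let ?w = "\<lambda>x. (1 - real k * x) ^ 4"
  let ?wr = "\<lambda>x. (1 - real k * (1 - x)) ^ 4"
  have sub: "{0..d} \<subseteq> {0..1}" "{d..1 - d} \<subseteq> {0..1}" "{1 - d..1} \<subseteq> {0..1}"
    using d by auto
  note D = set_integrable_squared_error[OF k0 _ sub(1)] set_integrable_squared_error[OF k0 _ sub(2)]
    set_integrable_squared_error[OF k0 _ sub(3)]
  have w: "set_integrable lborel {0..d} (\<lambda>x. (s' x)\<^sup>2 * ?w x)"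
    by (rule set_integrable_weighted_s'_squared[OF _ _ sub(1)]) (auto intro!: continuous_intros)
  have wr: "set_integrable lborel {1 - d..1} (\<lambda>x. (s' x)\<^sup>2 * ?wr x)"
    by (rule set_integrable_weighted_s'_squared[OF _ _ sub(3)]) (auto intro!: continuous_intros)
  define L where "L = (LBINT x:{0..d}. (s' x)\<^sup>2 * ?w x)"
  define R where "R = (LBINT x:{1 - d..1}. (s' x)\<^sup>2 * ?wr x)"
  have left: "\<bar>(LBINT x:{0..d}. ?D x) - c * L\<bar> \<le> E * d"
  proof -
    have "\<bar>(LBINT x:{0..d}. ?D x) - (LBINT x:{0..d}. c * ((s' x)\<^sup>2 * ?w x))\<bar> \<le> E * measure lborel {0..d}"
    proof (rule set_integral_diff_le[OF D(1) set_integrable_mult_right[OF w], where N = "{0, d}"])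
      fix x assume x: "x \<in> {0..d} - {0, d}"
      then have "min x (1 - x) = x"
        using d by auto
      then show "\<bar>?D x - c * ((s' x)\<^sup>2 * ?w x)\<bar> \<le> E"
        using squared_error_boundary[OF k, of x] x d
        unfolding E_def c_def d_def[symmetric] by simp
    qed (use d in auto)
    then show ?thesis
      unfolding set_integral_mult_right L_def using d by simp
  qed
  have right: "\<bar>(LBINT x:{1 - d..1}. ?D x) - c * R\<bar> \<le> E * d"
  proof -
    have "\<bar>(LBINT x:{1 - d..1}. ?D x) - (LBINT x:{1 - d..1}. c * ((s' x)\<^sup>2 * ?wr x))\<bar>
        \<le> E * measure lborel {1 - d..1}"
    proof (rule set_integral_diff_le[OF D(3) set_integrable_mult_right[OF wr], where N = "{1 - d, 1}"])
      fix x assume x: "x \<in> {1 - d..1} - {1 - d, 1}"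
      then have "min x (1 - x) = 1 - x"
        using d by auto
      then show "\<bar>?D x - c * ((s' x)\<^sup>2 * ?wr x)\<bar> \<le> E"
        using squared_error_boundary[OF k, of x] x d
        unfolding E_def c_def d_def[symmetric] by simp
    qed (use d in auto)
    then show ?thesis
      unfolding set_integral_mult_right R_def using d by simp
  qed
  have middle: "\<bar>LBINT x:{d..1 - d}. ?D x\<bar> \<le> (?S2 / 12 + C / 2)\<^sup>2 / real k ^ 4"
  proof -
    have "\<bar>(LBINT x:{d..1 - d}. ?D x) - (LBINT x:{d..1 - d}. 0)\<bar>
        \<le> (?S2 / 12 + C / 2)\<^sup>2 / real k ^ 4 * measure lborel {d..1 - d}"
      by (rule set_integral_diff_le[OF D(2) _ _ _ finite.emptyI])
        (use squared_error_interior(2)[OF k] d in \<open>auto simp: d_def set_integrable_def\<close>)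
    also have "\<dots> \<le> (?S2 / 12 + C / 2)\<^sup>2 / real k ^ 4 * 1"
      using d by (intro mult_left_mono) auto
    finally show ?thesis by simp
  qed
  have "{0..1} = {0..d} \<union> ({d..1 - d} \<union> {1 - d..1})"
    using d by auto
  then have "(LBINT x:{0..1}. ?D x) = (LBINT x:{0..d} \<union> ({d..1 - d} \<union> {1 - d..1}). ?D x)"
    by simp
  also have "\<dots> = (LBINT x:{0..d}. ?D x) + (LBINT x:{d..1 - d} \<union> {1 - d..1}. ?D x)"
  proof (rule set_integral_Un_AE)
    have "AE x in lborel. x \<notin> {d, 1 - d}"
      by (intro AE_not_in finite_imp_null_set_lborel) auto
    then show "AE x in lborel. \<not> (x \<in> {0..d} \<and> x \<in> {d..1 - d} \<union> {1 - d..1})"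
      by eventually_elim (use d in auto)
    show "set_integrable lborel ({d..1 - d} \<union> {1 - d..1}) ?D"
      using D by (intro set_integrable_Un) auto
  qed (use D in auto)
  also have "(LBINT x:{d..1 - d} \<union> {1 - d..1}. ?D x) = (LBINT x:{d..1 - d}. ?D x) + (LBINT x:{1 - d..1}. ?D x)"
  proof (rule set_integral_Un_AE)
    have "AE x in lborel. x \<notin> {1 - d}"
      by (intro AE_not_in finite_imp_null_set_lborel) auto
    then show "AE x in lborel. \<not> (x \<in> {d..1 - d} \<and> x \<in> {1 - d..1})"
      by eventually_elim auto
  qed (use D in auto)
  finally have split: "(LBINT x:{0..1}. ?D x) =
      (LBINT x:{0..d}. ?D x) + ((LBINT x:{d..1 - d}. ?D x) + (LBINT x:{1 - d..1}. ?D x))" .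
  have R: "R = (LBINT x:{0..d}. (s' (1 - x))\<^sup>2 * ?w x)"
    unfolding R_def set_lebesgue_integral_one_minus by simp
  have "set_integrable lborel {0..d} (\<lambda>x. (s' (1 - x))\<^sup>2 * ?w x)"
    using wr unfolding set_integrable_one_minus by simp
  then have LR: "(LBINT x:{0..d}. ((s' x)\<^sup>2 + (s' (1 - x))\<^sup>2) * ?w x) = L + R"
    using w unfolding L_def R by (simp add: distrib_right set_integral_add(2))
  have tri: "\<bar>a + (m + b) - c * (L + R)\<bar> \<le> e + e + f"
    if "\<bar>a - c * L\<bar> \<le> e" "\<bar>b - c * R\<bar> \<le> e" "\<bar>m\<bar> \<le> f" for a b m c L R e f :: real
    using that unfolding distrib_left by linarith
  have "\<bar>(LBINT x:{0..1}. ?D x) - c * (L + R)\<bar> \<le> E * d + E * d + (?S2 / 12 + C / 2)\<^sup>2 / real k ^ 4"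
    unfolding split by (rule tri[OF left right middle])
  also have "\<dots> = (?S1 * ?S2 + C * ?S1 + 37 / 72 * ?S2\<^sup>2 + 7 / 6 * (C * ?S2) + C\<^sup>2) / (2 * real k ^ 4)"
    using k0 unfolding E_def d_def by (simp add: field_simps power2_eq_square eval_nat_numeral)
  also have "\<dots> \<le> (?S1 * ?S2 + 2 * C * ?S1 + ?S2\<^sup>2 + 2 * C * ?S2 + 4 * C\<^sup>2) / (2 * real k ^ 4)"
  proof (rule divide_right_mono)
    have "0 \<le> C * ?S1" "0 \<le> C * ?S2" "0 \<le> ?S2\<^sup>2" "0 \<le> C\<^sup>2"
      using C_pos sup_norm_nonneg by auto
    then show "?S1 * ?S2 + C * ?S1 + 37 / 72 * ?S2\<^sup>2 + 7 / 6 * (C * ?S2) + C\<^sup>2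
        \<le> ?S1 * ?S2 + 2 * C * ?S1 + ?S2\<^sup>2 + 2 * C * ?S2 + 4 * C\<^sup>2"
      unfolding mult.assoc by linarith
  qed simp
  finally show ?thesis
    unfolding c_def LR[symmetric] d_def .
qed

end

section \<open>The bias of the toy partition\<close>

theorem corollary6:
  fixes k :: nat and s s' s'' :: "real \<Rightarrow> real" and C\<^sub>3 :: real
    and M :: "'a measure" and X :: "'a \<Rightarrow> real"
  assumes k: "k \<ge> 2"
    and M: "prob_space M" and X: "X \<in> borel_measurable M"
    and X_uniform: "distr M borel X = uniform_measure lborel {0..<1}"
    and s': "\<And>x. x \<in> {0..<1} \<Longrightarrow> (s has_real_derivative s' x) (at x within {0..<1})"
    and s'': "\<And>x. x \<in> {0..<1} \<Longrightarrow> (s' has_real_derivative s'' x) (at x within {0..<1})"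
    and C3_pos: "C\<^sub>3 > 0"
    and taylor: "\<And>t x. t \<in> {0..<1} \<Longrightarrow> x \<in> {0..<1} \<Longrightarrow>
      \<bar>s t - s x - s' x * (t - x) - 1/2 * s'' x * (t - x)\<^sup>2\<bar> \<le> C\<^sub>3 * \<bar>t - x\<bar> ^ 3"
  shows
    "(\<forall>x \<in> {1 / real k..1 - 1 / real k}.
        \<bar>bias_inf M X s (toy_distribution k) x - (s'' x)\<^sup>2 / (144 * real k ^ 4)\<bar>
          \<le> 3 * C\<^sub>3 * (sup_norm s'' + 3 * C\<^sub>3 / 2) / (4 * real k ^ 5)) \<and>
     (\<forall>x \<in> {0<..<1} - {1 / real k..1 - 1 / real k}.
        \<bar>bias_inf M X s (toy_distribution k) x
            - (s' x)\<^sup>2 * (1 - real k * min x (1 - x)) ^ 4 / (16 * (real k)\<^sup>2)\<bar>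
          \<le> (sup_norm s' * sup_norm s'' + 2 * C\<^sub>3 * sup_norm s' + (sup_norm s'')\<^sup>2
               + C\<^sub>3 * sup_norm s'' + 2 * C\<^sub>3\<^sup>2) / (4 * real k ^ 3)) \<and>
     \<bar>(LBINT x:{0..1}. bias_inf M X s (toy_distribution k) x)
         - 1 / (16 * (real k)\<^sup>2) * (LBINT x:{0..1 / real k}. ((s' x)\<^sup>2 + (s' (1 - x))\<^sup>2) * (1 - real k * x) ^ 4)\<bar>
       \<le> (sup_norm s' * sup_norm s'' + 2 * C\<^sub>3 * sup_norm s' + (sup_norm s'')\<^sup>2
            + 2 * C\<^sub>3 * sup_norm s'' + 4 * C\<^sub>3\<^sup>2) / (2 * real k ^ 4) \<and>
     \<bar>(LBINT x:{1 / real k..1 - 1 / real k}. bias_inf M X s (toy_distribution k) x)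
         - 1 / (144 * real k ^ 4) * (LBINT x:{1 / real k..1 - 1 / real k}. (s'' x)\<^sup>2)\<bar>
       \<le> 3 * C\<^sub>3 * (sup_norm s'' + 3 * C\<^sub>3 / 2) / (4 * real k ^ 5)"
proof -
  interpret cubic_taylor s s' s'' C\<^sub>3
    by unfold_locales (fact s' s'' C3_pos taylor)+
  have k0: "k > 0"
    using k by simp
  have bias: "bias_inf M X s (toy_distribution k) x = (toy_mean s k x - s x)\<^sup>2" if "x \<in> {0..<1}" for x
    by (rule bias_inf_toy_distribution[OF X X_uniform set_borel_measurable_s k0 that])
  have interior_sub: "{1 / real k..1 - 1 / real k} \<subseteq> {0..<1}"
  proof
    fix x assume "x \<in> {1 / real k..1 - 1 / real k}"
    moreover have "0 < 1 / real k"
      using k0 by simp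
    ultimately show "x \<in> {0..<1}"
      unfolding atLeastAtMost_iff atLeastLessThan_iff by linarith
  qed
  \<comment> \<open>The point \<open>1\<close>, which lies in no cell, is a null set.\<close>
  have unit: "(LBINT x:{0..1}. bias_inf M X s (toy_distribution k) x) = (LBINT x:{0..1}. (toy_mean s k x - s x)\<^sup>2)"
  proof -
    have "(LBINT x:{0..1}. bias_inf M X s (toy_distribution k) x) = (LBINT x:{0..<1}. bias_inf M X s (toy_distribution k) x)"
      by (rule set_integral_discrete_difference[where X = "{1}"]) auto
    also have "\<dots> = (LBINT x:{0..<1}. (toy_mean s k x - s x)\<^sup>2)"
      using bias by (intro set_lebesgue_integral_cong) auto
    also have "\<dots> = (LBINT x:{0..1}. (toy_mean s k x - s x)\<^sup>2)"
      by (rule set_integral_discrete_difference[where X = "{1}"]) auto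
    finally show ?thesis .
  qed
  have interior: "(LBINT x:{1 / real k..1 - 1 / real k}. bias_inf M X s (toy_distribution k) x) =
      (LBINT x:{1 / real k..1 - 1 / real k}. (toy_mean s k x - s x)\<^sup>2)"
    using bias interior_sub by (intro set_lebesgue_integral_cong) auto
  let ?S1 = "sup_norm s'" and ?S2 = "sup_norm s''"
  have "(?S1 * ?S2 + C\<^sub>3 * ?S1 + ?S2\<^sup>2 / 2 + C\<^sub>3 * ?S2 + C\<^sub>3\<^sup>2 / 2) / (4 * real k ^ 3)
      \<le> (?S1 * ?S2 + 2 * C\<^sub>3 * ?S1 + ?S2\<^sup>2 + C\<^sub>3 * ?S2 + 2 * C\<^sub>3\<^sup>2) / (4 * real k ^ 3)"
    using C3_pos sup_norm_nonneg by (intro divide_right_mono add_mono) auto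
  note boundary = order_trans[OF squared_error_boundary[OF k] this]
  show ?thesis
    unfolding unit interior
  proof (intro conjI ballI)
    fix x assume x: "x \<in> {1 / real k..1 - 1 / real k}"
    then show "\<bar>bias_inf M X s (toy_distribution k) x - (s'' x)\<^sup>2 / (144 * real k ^ 4)\<bar>
        \<le> 3 * C\<^sub>3 * (?S2 + 3 * C\<^sub>3 / 2) / (4 * real k ^ 5)"
      using squared_error_interior(1)[OF k x] bias interior_sub by (metis subsetD)
  next
    fix x assume "x \<in> {0<..<1} - {1 / real k..1 - 1 / real k}"
    then have x: "0 < x" "x < 1" "x < 1 / real k \<or> 1 - 1 / real k < x" and x01: "x \<in> {0..<1}"
      by auto
    show "\<bar>bias_inf M X s (toy_distribution k) x
            - (s' x)\<^sup>2 * (1 - real k * min x (1 - x)) ^ 4 / (16 * (real k)\<^sup>2)\<bar>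
          \<le> (?S1 * ?S2 + 2 * C\<^sub>3 * ?S1 + ?S2\<^sup>2 + C\<^sub>3 * ?S2 + 2 * C\<^sub>3\<^sup>2) / (4 * real k ^ 3)"
      unfolding bias[OF x01] by (rule boundary[OF x])
  qed (rule integral_squared_error[OF k] integral_squared_error_interior[OF k])+
qed

end
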